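(* Let $(\Omega,\nu,\Xi,\kappa)\in\mathcal{K}$, let $m\in\mathbb{N}$, let $\Omega_m=\{j_1,\dots,j_m\}\subset\mathbb{N}$ be a set of $m$ distinct indices, and let $n=\dim\Xi(\Omega_m)$. Let $X$ and $Y$ be real Banach spaces (of functions on $\Omega$) both containing $\Xi(\Omega_m)$, with $U_X$ the closed unit ball of $X$; view $\Xi(\Omega_m)$ as a subspace $X_n\subset X$ and $Y_n\subset Y$. Let $\Lambda:X\to Y$ be a compact multiplier operator which acts on the block $\Xi^{j_s}$ as multiplication by $\lambda_s\in\mathbb{R}$, $s=1,\dots,m$, and let $\Lambda_n=\mathrm{diag}\{\lambda_1I_{d_{j_1}},\dots,\lambda_mI_{d_{j_m}}\}$. Then for every $k\in\mathbb{N}$ $$e_{k}(\Lambda U_{X}, Y) \geq 2^{-1-k/n}\, \frac{|\det \Lambda_{n}|^{1/n}}{M_{B^{*}_{X_{n}}}\, M_{(B^{*}_{Y_{n}})^{o}}}.$$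
   Context: The class $\mathcal{K}$: $(\Omega,\nu)$ is a measure space on a compact set $\Omega\subset\mathbb{R}^s$, $\Xi=\{\xi_k\}_{k\in\mathbb{N}}$ is a set of orthonormal functions in $L_2(\Omega,\nu)$, and $\kappa=\{k_j\}_{j\in\mathbb{N}}$ is an increasing sequence of positive integers with $k_1=1$; one writes $(\Omega,\nu,\Xi,\kappa)\in\mathcal{K}$ if for some $C>0$ and every $j\in\mathbb{N}$, $\sum_{k=k_j}^{k_{j+1}-1}|\xi_k(x)|^2\le C d_j$ for a.e. $x\in\Omega$, where $d_j=k_{j+1}-k_j$. Blocks: $\Xi^j=\mathrm{span}\{\xi_k\}_{k=k_j}^{k_{j+1}-1}$ (real span) and $\Xi(\Omega_m)=\mathrm{span}\{\Xi^{j_s}\}_{s=1}^m$, so $n=\sum_{s=1}^m d_{j_s}$. With $l_0=0$, $l_s=\sum_{t=1}^s d_{j_t}$, re-enumerate the chosen basis functions as $\eta_1,\dots,\eta_n$ so that $\Xi^{j_s}=\mathrm{span}\{\eta_i: l_{s-1}+1\le i\le l_s\}$. The coordinate isomorphism is $J:\mathbb{R}^n\to\Xi(\Omega_m)$, $J\alpha=\sum_{l=1}^n\alpha_l\eta_l$. $I_s$ denotes the $s\times s$ identity matrix. Norms on $\mathbb{R}^n$: $\|\alpha\|^*_{X_n}=\|J\alpha\|_X$, $\|\alpha\|^*_{Y_n}=\|J\alpha\|_Y$, with unit balls $B^*_{X_n}$ and $B^*_{Y_n}$. Lévy mean: if $B$ is the unit ball of a norm $\|\cdot\|$ on $\mathbb{R}^n$,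 then $M_B=\int_{\mathbb{S}^{n-1}}\|\alpha\|\,d\mu(\alpha)$, where $\mu$ is the normalized rotation invariant measure on the Euclidean unit sphere $\mathbb{S}^{n-1}\subset\mathbb{R}^n$. The dual norm is $\|\xi\|^o=\sup_{\sigma\in B}|\langle\xi,\sigma\rangle|$ (Euclidean inner product) and $B^o$ is its unit ball; thus $M_{B^o}=\int_{\mathbb{S}^{n-1}}\|\alpha\|^o\,d\mu(\alpha)$. Entropy numbers: for a subset $A$ of a Banach space $Y$ with closed unit ball $B_Y$, $e_k(A,Y)$ is the infimum of all $\epsilon>0$ for which there exist $y_1,\dots,y_{2^{k-1}}\in Y$ with $A\subset\bigcup_{i=1}^{2^{k-1}}(y_i+\epsilon B_Y)$. *)

theory Defs
  imports "HOL-Analysis.Analysis" "HOL-Library.Function_Algebras"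
begin

section \<open>Orthonormal systems and the class K\<close>

definition fscale :: "real \<Rightarrow> ('a \<Rightarrow> real) \<Rightarrow> 'a \<Rightarrow> real" where
  "fscale c f = (\<lambda>x. c * f x)"

interpretation fun_space: vector_space fscale
  by unfold_locales (auto simp: fscale_def fun_eq_iff algebra_simps)

text \<open>Sequences indexed by the positive integers are functions on \<open>nat\<close> whose value at \<open>0\<close> is
  irrelevant.\<close>

definition orthonormal_L2 :: "'a measure \<Rightarrow> (nat \<Rightarrow> 'a \<Rightarrow> real) \<Rightarrow> bool" where
  "orthonormal_L2 \<nu> \<xi> \<longleftrightarrow>
     (\<forall>k\<ge>1. \<xi> k \<in> borel_measurable \<nu> \<and> integrable \<nu> (\<lambda>x. (\<xi> k x)\<^sup>2)) \<and>
     (\<forall>k\<ge>1. \<forall>l\<ge>1. integral\<^sup>L \<nu> (\<lambda>x. \<xi> k x * \<xi> l x) = (if k = l then 1 else 0))"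

definition block_idx :: "(nat \<Rightarrow> nat) \<Rightarrow> nat \<Rightarrow> nat set" where
  "block_idx \<kappa> j = {\<kappa> j..<\<kappa> (j + 1)}"

definition block_dim :: "(nat \<Rightarrow> nat) \<Rightarrow> nat \<Rightarrow> nat" where
  "block_dim \<kappa> j = \<kappa> (j + 1) - \<kappa> j"

definition class_K ::
  "(real^'s) set \<Rightarrow> (real^'s) measure \<Rightarrow> (nat \<Rightarrow> real^'s \<Rightarrow> real) \<Rightarrow> (nat \<Rightarrow> nat) \<Rightarrow> bool" where
  "class_K \<Omega> \<nu> \<xi> \<kappa> \<longleftrightarrow>
     compact \<Omega> \<and> space \<nu> = \<Omega> \<and> orthonormal_L2 \<nu> \<xi> \<and>
     \<kappa> 1 = 1 \<and> strict_mono_on {1..} \<kappa> \<and>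
     (\<exists>C>0. \<forall>j\<ge>1. AE x in \<nu>. (\<Sum>k\<in>block_idx \<kappa> j. \<bar>\<xi> k x\<bar>\<^sup>2) \<le> C * real (block_dim \<kappa> j))"

definition block :: "(nat \<Rightarrow> 'a \<Rightarrow> real) \<Rightarrow> (nat \<Rightarrow> nat) \<Rightarrow> nat \<Rightarrow> ('a \<Rightarrow> real) set" where
  "block \<xi> \<kappa> j = fun_space.span (\<xi> ` block_idx \<kappa> j)"

definition blocks_span ::
  "(nat \<Rightarrow> 'a \<Rightarrow> real) \<Rightarrow> (nat \<Rightarrow> nat) \<Rightarrow> (nat \<Rightarrow> nat) \<Rightarrow> nat \<Rightarrow> ('a \<Rightarrow> real) set" where
  "blocks_span \<xi> \<kappa> j m = fun_space.span (\<Union>s\<in>{1..m}. block \<xi> \<kappa> (j s))"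

text \<open>The partial sums $l_s$ of the dimensions of the chosen blocks, with $l_0 = 0$.\<close>

definition block_end :: "(nat \<Rightarrow> nat) \<Rightarrow> (nat \<Rightarrow> nat) \<Rightarrow> nat \<Rightarrow> nat" where
  "block_end \<kappa> j s = (\<Sum>t=1..s. block_dim \<kappa> (j t))"

definition block_enumeration ::
  "(nat \<Rightarrow> 'a \<Rightarrow> real) \<Rightarrow> (nat \<Rightarrow> nat) \<Rightarrow> (nat \<Rightarrow> nat) \<Rightarrow> nat \<Rightarrow> nat \<Rightarrow> (nat \<Rightarrow> 'a \<Rightarrow> real) \<Rightarrow> bool" where
  "block_enumeration \<xi> \<kappa> j m n \<eta> \<longleftrightarrow>
     bij_betw \<eta> {1..n} (\<Union>s\<in>{1..m}. \<xi> ` block_idx \<kappa> (j s)) \<and>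
     (\<forall>s\<in>{1..m}. block \<xi> \<kappa> (j s) =
        fun_space.span (\<eta> ` {block_end \<kappa> j (s - 1) + 1..block_end \<kappa> j s}))"

text \<open>The unique \<open>s\<close> with $l_{s-1} < i \le l_s$.\<close>

definition block_of :: "(nat \<Rightarrow> nat) \<Rightarrow> (nat \<Rightarrow> nat) \<Rightarrow> nat \<Rightarrow> nat" where
  "block_of \<kappa> j i = (LEAST s. i \<le> block_end \<kappa> j s)"

text \<open>In the next two definitions \<open>num\<close> is the bijection from the index type onto \<open>{1..n}\<close> that
  numbers the coordinates of \<open>real^'n\<close>.\<close>

definition coord_iso ::
  "('n::finite \<Rightarrow> nat) \<Rightarrow> (nat \<Rightarrow> 'a \<Rightarrow> real) \<Rightarrow> real^'n \<Rightarrow> 'a \<Rightarrow> real" where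
  "coord_iso num \<eta> \<alpha> = (\<Sum>i\<in>UNIV. fscale (\<alpha> $ i) (\<eta> (num i)))"

definition multiplier_matrix ::
  "('n::finite \<Rightarrow> nat) \<Rightarrow> (nat \<Rightarrow> nat) \<Rightarrow> (nat \<Rightarrow> nat) \<Rightarrow> (nat \<Rightarrow> real) \<Rightarrow> real^'n^'n" where
  "multiplier_matrix num \<kappa> j lam =
     (\<chi> i i'. if i = i' then lam (block_of \<kappa> j (num i)) else 0)"

section \<open>Banach spaces of functions and multiplier operators\<close>

text \<open>A Banach space \<open>'x\<close> of functions on \<open>space \<nu>\<close> consists of a linear space \<open>F\<close> of functions and
  a linear surjection \<open>cls\<close> from \<open>F\<close> onto \<open>'x\<close> that sends a function to the element it represents;
  the norm of a function \<open>f\<close> in \<open>F\<close> is \<open>norm (cls f)\<close>. Functions that agree on \<open>space \<nu>\<close> represent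
  the same element, and functions representing the same element agree almost everywhere. This
  comprises spaces of genuine functions, where the values on \<open>space \<nu>\<close> are determined by the
  element (such as continuous functions with the supremum norm), as well as spaces of classes
  modulo null functions (such as the Lebesgue spaces).\<close>

definition banach_function_space ::
  "'a measure \<Rightarrow> ('a \<Rightarrow> real) set \<Rightarrow> (('a \<Rightarrow> real) \<Rightarrow> 'x::banach) \<Rightarrow> bool" where
  "banach_function_space \<nu> F cls \<longleftrightarrow>
     fun_space.subspace F \<and>
     (\<forall>f\<in>F. \<forall>g\<in>F. cls (f + g) = cls f + cls g) \<and>
     (\<forall>c. \<forall>f\<in>F. cls (fscale c f) = c *\<^sub>R cls f) \<and>
     cls ` F = UNIV \<and>
     (\<forall>f. (\<forall>x\<in>space \<nu>. f x = 0) \<longrightarrow> f \<in> F \<and> cls f = 0) \<and>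
     (\<forall>f\<in>F. cls f = 0 \<longrightarrow> (AE x in \<nu>. f x = 0))"

definition compact_operator :: "('x::real_normed_vector \<Rightarrow> 'y::real_normed_vector) \<Rightarrow> bool" where
  "compact_operator T \<longleftrightarrow> bounded_linear T \<and> compact (closure (T ` cball 0 1))"

definition acts_as_scalar ::
  "(('a \<Rightarrow> real) \<Rightarrow> 'x) \<Rightarrow> ('a \<Rightarrow> real) set \<Rightarrow> (('a \<Rightarrow> real) \<Rightarrow> 'y) \<Rightarrow> ('x \<Rightarrow> 'y) \<Rightarrow>
    ('a \<Rightarrow> real) set \<Rightarrow> real \<Rightarrow> bool" where
  "acts_as_scalar clsX FY clsY T V c \<longleftrightarrow>
     (\<forall>f\<in>V. fscale c f \<in> FY \<and> T (clsX f) = clsY (fscale c f))"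

text \<open>A multiplier operator multiplies each basis function lying in the domain space by a scalar.
  No Fourier coefficients are involved, since functions in the domain space need not have any.\<close>

definition multiplier_operator ::
  "(nat \<Rightarrow> 'a \<Rightarrow> real) \<Rightarrow> ('a \<Rightarrow> real) set \<Rightarrow> (('a \<Rightarrow> real) \<Rightarrow> 'x::real_vector) \<Rightarrow>
    ('a \<Rightarrow> real) set \<Rightarrow> (('a \<Rightarrow> real) \<Rightarrow> 'y::real_vector) \<Rightarrow> ('x \<Rightarrow> 'y) \<Rightarrow> bool" where
  "multiplier_operator \<xi> FX clsX FY clsY T \<longleftrightarrow>
     linear T \<and>
     (\<exists>c. \<forall>k\<ge>1. \<xi> k \<in> FX \<longrightarrow> acts_as_scalar clsX FY clsY T {\<xi> k} (c k))"

section \<open>Levy means and entropy numbers\<close>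

definition normalized_rotation_invariant :: "(real^'n) measure \<Rightarrow> bool" where
  "normalized_rotation_invariant \<mu> \<longleftrightarrow>
     sets \<mu> = sets (restrict_space borel (sphere 0 1)) \<and> emeasure \<mu> (sphere 0 1) = 1 \<and>
     (\<forall>U. orthogonal_transformation U \<longrightarrow> distr \<mu> \<mu> U = \<mu>)"

text \<open>The Levy mean of the unit ball of the norm \<open>N\<close>.\<close>

definition levy_mean :: "(real^'n) measure \<Rightarrow> (real^'n \<Rightarrow> real) \<Rightarrow> real" where
  "levy_mean \<mu> N = integral\<^sup>L \<mu> N"

definition dual_norm :: "(real^'n \<Rightarrow> real) \<Rightarrow> real^'n \<Rightarrow> real" where
  "dual_norm N x = (SUP y\<in>{y. N y \<le> 1}. \<bar>x \<bullet> y\<bar>)"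

text \<open>Meaningful for bounded \<open>A\<close>; the infimum over the empty set is unspecified.\<close>

definition entropy_number :: "nat \<Rightarrow> 'y::real_normed_vector set \<Rightarrow> real" where
  "entropy_number k A =
     Inf {\<epsilon>. \<epsilon> > 0 \<and> (\<exists>y::nat \<Rightarrow> 'y. A \<subseteq> (\<Union>i\<in>{1..2 ^ (k - 1)}. cball (y i) \<epsilon>))}"

end

theory Submission
  imports Defs "HOL-Probability.Probability_Measure"
begin

text \<open>Pulled back to the coefficient space, a covering of \<open>\<Lambda> U\<^sub>X\<close> by $2^{k-1}$ balls of radius
  \<open>\<epsilon>\<close> covers $\Lambda_n B^*_{X_n}$ by as many translates of $2 \epsilon B^*_{Y_n}$, so
  $|\det \Lambda_n| \, |B^*_{X_n}| \le 2^{k-1} (2 \epsilon)^n |B^*_{Y_n}|$. It remains to bound the two volumes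
  by the Levy means. Averaging a function on the sphere repeatedly with its reflections makes it
  almost constant, without changing its mean. Replacing a norm by such an average does not increase
  the volume of its unit ball, which yields $|B^*_{X_n}| \ge M^{-n} |B_2|$. Replacing a support function
  by such an average replaces the body by a Minkowski symmetral, whose volume is not smaller since it
  is bounded below by a Steiner symmetral; this yields Urysohn's inequality
  $|B^*_{Y_n}| \le (M_{(B^*_{Y_n})^o})^n |B_2|$.\<close>

section \<open>Reflection averages\<close>

text \<open>The measure \<open>\<mu>\<close> is known only through its rotation invariance, so it
  enters only through finite averages over reflections, which keep its integrals. These averages
  take the place of polar coordinates and Jensen's inequality, and the same averaging lemma serves a
  norm and a support function. No limit of bodies or functions is formed: for each slack \<delta>
  finitely many reflections push the maximum on the sphere below mean + \<delta>, and \<delta> tends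
  to 0 only in the resulting inequality between numbers. It is this upper bound on the sphere that
  both volume estimates consume. The factor 2 in 2 \<epsilon> arises because the centres of the
  covering balls lie in Y and possibly outside Y_n; on the coefficient space only the diameter of
  the pulled-back balls is controlled. It produces the -1 in the exponent of the constant, and
  relaxing 2^(k-1) to 2^k produces the -k/n.\<close>

definition reflect :: "'a::real_inner \<Rightarrow> 'a \<Rightarrow> 'a" where
  "reflect u x = x - (2 * (x \<bullet> u) / (u \<bullet> u)) *\<^sub>R u"

lemma linear_reflect: "linear (reflect u)"
  by (rule linearI)
    (simp_all add: reflect_def inner_add_left algebra_simps add_divide_distrib)

text \<open>The quotient 0/0 is 0, so the zero direction gives the identity. Directions such as
  \<open>x - y\<close> can therefore be used without excluding \<open>x = y\<close>.\<close>

lemma reflect_0 [simp]: "reflect 0 x = x"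
  by (simp add: reflect_def)

lemma inner_reflect_left: "reflect u x \<bullet> y = x \<bullet> reflect u y"
  by (simp add: reflect_def inner_diff_left inner_diff_right inner_commute)

lemma reflect_reflect [simp]: "reflect u (reflect u x) = x"
proof (cases "u = 0")
  case False
  then have "reflect u x \<bullet> u = - (x \<bullet> u)"
    by (simp add: reflect_def inner_diff_left)
  then show ?thesis
    by (simp add: reflect_def[of u "reflect u x"]) (simp add: reflect_def)
qed simp

text \<open>A self-adjoint linear involution preserves the inner product.\<close>

lemma orthogonal_transformation_reflect: "orthogonal_transformation (reflect u)"
  by (simp add: orthogonal_transformation_def linear_reflect inner_reflect_left)

lemma norm_reflect [simp]: "norm (reflect u x) = norm x"
  using orthogonal_transformation_norm orthogonal_transformation_reflect by blast

lemma dist_reflect [simp]: "dist (reflect u x) (reflect u y) = dist x y"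
  by (simp add: dist_norm linear_diff[OF linear_reflect, symmetric])

text \<open>The hyperplane orthogonal to \<open>x - y\<close> bisects the segment between two points
  of equal norm. Hence reflections act transitively on spheres, which is used to move caps and to
  turn a direction into a basis vector.\<close>

lemma reflect_swap:
  assumes "norm x = norm y"
  shows "reflect (x - y) x = y"
proof (cases "x = y")
  case False
  have "(x - y) \<bullet> (x - y) = 2 * (x \<bullet> (x - y))"
    using assms by (simp add: inner_diff_left inner_diff_right inner_commute norm_eq)
  moreover have "(x - y) \<bullet> (x - y) \<noteq> 0"
    using False by simp
  ultimately show ?thesis
    by (simp add: reflect_def)
qed simp

text \<open>Finitely many steps, each with its own direction: whatever survives one step (Lipschitz
  constant, mean, being a norm, dominating the support function of a large body) carries over by
  induction.\<close>

inductive reflection_average :: "('a::real_inner \<Rightarrow> real) \<Rightarrow> ('a \<Rightarrow> real) \<Rightarrow> bool" for h where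
  base: "reflection_average h h"
| step: "reflection_average h g \<Longrightarrow> reflection_average h (\<lambda>x. (g x + g (reflect u x)) / 2)"

lemma reflection_average_trans:
  assumes "reflection_average g f" "reflection_average h g"
  shows "reflection_average h f"
  using assms by (induction rule: reflection_average.induct) (auto intro: reflection_average.step)

text \<open>The constant does not grow, so the gain in \<open>reflection_average_decrease\<close> is
  the same at every stage of the averaging.\<close>

lemma reflection_average_lipschitz:
  assumes "reflection_average h g" "\<And>x y. \<bar>h x - h y\<bar> \<le> L * dist x y"
  shows "\<bar>g x - g y\<bar> \<le> L * dist x y"
  using assms(1)
proof (induction arbitrary: x y rule: reflection_average.induct)
  case (step g u)
  from step.IH[of x y] step.IH[of "reflect u x" "reflect u y"] show ?case
    unfolding dist_reflect abs_le_iff by argo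
qed (rule assms(2))

text \<open>A cap on which the function is below its maximum is copied by one reflection per cap of a
  finite cover; each copy at most halves the gap on the caps treated before.\<close>

lemma spread_caps:
  fixes g :: "'a::real_inner \<Rightarrow> real"
  assumes "finite D" "D \<subseteq> sphere 0 1" "x0 \<in> sphere 0 1"
    and "\<And>x. x \<in> sphere 0 1 \<Longrightarrow> g x \<le> M"
    and "\<And>x. x \<in> sphere 0 1 \<inter> ball x0 r \<Longrightarrow> g x \<le> M - w" and "w \<ge> 0"
  shows "\<exists>f. reflection_average g f \<and> (\<forall>x\<in>sphere 0 1. f x \<le> M) \<and>
           (\<forall>d\<in>insert x0 D. \<forall>x\<in>sphere 0 1 \<inter> ball d r. f x \<le> M - w / 2 ^ card D)"
  using assms(1,2)
proof (induction D rule: finite_induct)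
  case empty
  then show ?case
    using assms by (intro exI[of _ g]) (auto intro: reflection_average.base)
next
  case (insert d D)
  then obtain f where f: "reflection_average g f" "\<And>x. x \<in> sphere 0 1 \<Longrightarrow> f x \<le> M"
    "\<And>d x. d \<in> insert x0 D \<Longrightarrow> x \<in> sphere 0 1 \<inter> ball d r \<Longrightarrow> f x \<le> M - w / 2 ^ card D"
    by (metis insert_subset)
  \<comment> \<open>The isometry exchanging \<open>d\<close> and \<open>x0\<close> carries the cap
    around \<open>d\<close> onto the cap around \<open>x0\<close>, where \<open>f\<close> is already
    below \<open>M\<close>.\<close>
  define u where "u = d - x0"
  have d: "reflect u d = x0"
    unfolding u_def using insert.prems assms(3) by (intro reflect_swap) auto
  define f' where "f' = (\<lambda>x. (f x + f (reflect u x)) / 2)"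
  have half: "f' x \<le> M - w / 2 ^ card (insert d D)"
    if "x \<in> sphere 0 1" "f x \<le> M - w / 2 ^ card D \<or> f (reflect u x) \<le> M - w / 2 ^ card D" for x
  proof -
    have "f x \<le> M" "f (reflect u x) \<le> M"
      using that(1) by (auto intro!: f(2))
    moreover have "w / 2 ^ card (insert d D) = (w / 2 ^ card D) / 2"
      using insert.hyps by simp
    ultimately show ?thesis
      unfolding f'_def using that(2) by (simp only: field_simps) linarith
  qed
  show ?case
  proof (intro exI[of _ f'] conjI ballI)
    show "reflection_average g f'"
      unfolding f'_def by (intro reflection_average.step f)
    show "f' x \<le> M" if "x \<in> sphere 0 1" for x
    proof -
      have "f x \<le> M" "f (reflect u x) \<le> M"
        using that by (auto intro!: f(2))
      then show ?thesis by (simp add: f'_def)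
    qed
    fix c x assume c: "c \<in> insert x0 (insert d D)" and x: "x \<in> sphere 0 1 \<inter> ball c r"
    show "f' x \<le> M - w / 2 ^ card (insert d D)"
    proof (cases "c = d")
      case True
      then have "reflect u x \<in> sphere 0 1 \<inter> ball x0 r"
        using x dist_reflect[of u d x] d by auto
      then show ?thesis
        using half f(3) x by blast
    next
      case False
      then show ?thesis
        using half f(3) x c by blast
    qed
  qed
qed

text \<open>The order of quantifiers is the point: \<open>e\<close> depends on \<open>w\<close>,
  \<open>L\<close> and the space alone. A drop by \<open>w\<close> at one point persists on a cap
  whose radius is fixed by \<open>L\<close>, and by compactness a fixed number of such caps covers
  the sphere.\<close>

lemma reflection_average_decrease:
  fixes L w :: real
  assumes "w > 0" "L > 0"
  obtains e where "e > 0"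
    "\<And>g::'a::euclidean_space \<Rightarrow> real. \<And>M x0. (\<And>x y. \<bar>g x - g y\<bar> \<le> L * dist x y) \<Longrightarrow>
       (\<And>x. x \<in> sphere 0 1 \<Longrightarrow> g x \<le> M) \<Longrightarrow> x0 \<in> sphere 0 1 \<Longrightarrow> g x0 \<le> M - w \<Longrightarrow>
       \<exists>f. reflection_average g f \<and> (\<forall>x\<in>sphere 0 1. f x \<le> M - e)"
proof -
  \<comment> \<open>On a ball of this radius an \<open>L\<close>-Lipschitz function moves by at most
    \<open>w / 2\<close> from its value at the centre, so half of the drop at \<open>x0\<close>
    remains.\<close>
  define r where "r = w / (2 * L)"
  have "r > 0" using assms by (simp add: r_def)
  have "compact (sphere 0 1 :: 'a set)" by simp
  then obtain D where D: "D \<subseteq> sphere 0 1" "finite D" "sphere 0 1 \<subseteq> (\<Union>d\<in>D. ball d r :: 'a set)"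
  proof (rule compactE_image)
    show "sphere 0 1 \<subseteq> (\<Union>d\<in>sphere 0 1. ball d r :: 'a set)"
      using \<open>r > 0\<close> by (intro subsetI UN_I) auto
  qed auto
  show ?thesis
  proof (rule that)
    show "w / 2 / 2 ^ card D > 0" using assms by simp
    fix g :: "'a \<Rightarrow> real" and M x0
    assume L: "\<And>x y. \<bar>g x - g y\<bar> \<le> L * dist x y"
      and M: "\<And>x. x \<in> sphere 0 1 \<Longrightarrow> g x \<le> M" and x0: "x0 \<in> sphere 0 1" "g x0 \<le> M - w"
    have "g x \<le> M - w / 2" if "x \<in> sphere 0 1 \<inter> ball x0 r" for x
    proof -
      have "L * dist x x0 \<le> L * r"
        using that assms by (intro mult_left_mono) (auto simp: dist_commute)
      also have "L * r = w / 2" using assms by (simp add: r_def)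
      finally show ?thesis using L[of x x0] x0 by linarith
    qed
    moreover have "w / 2 \<ge> 0" using assms by simp
    ultimately obtain f where "reflection_average g f"
      "\<forall>d\<in>insert x0 D. \<forall>x\<in>sphere 0 1 \<inter> ball d r. f x \<le> M - w / 2 / 2 ^ card D"
      using spread_caps[of D x0 g M r "w / 2", OF D(2,1) x0(1) M] by blast
    then show "\<exists>f. reflection_average g f \<and> (\<forall>x\<in>sphere 0 1. f x \<le> M - w / 2 / 2 ^ card D)"
      using D(3) by (intro exI[of _ f]) blast
  qed
qed

section \<open>Means over the sphere under a rotation invariant probability measure\<close>

context
  fixes \<mu> :: "(real^'n) measure"
  assumes \<mu>: "normalized_rotation_invariant \<mu>"
begin

lemma sets_rotation_invariant: "sets \<mu> = sets (restrict_space borel (sphere 0 1))"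
  using \<mu> by (simp add: normalized_rotation_invariant_def)

lemma space_rotation_invariant: "space \<mu> = sphere 0 1"
  using sets_eq_imp_space_eq[OF sets_rotation_invariant] by (simp add: space_restrict_space)

lemma prob_space_rotation_invariant: "prob_space \<mu>"
  using \<mu> by (intro prob_spaceI) (simp add: normalized_rotation_invariant_def space_rotation_invariant)

lemma integrable_rotation_invariant:
  assumes "continuous_on UNIV (h :: real^'n \<Rightarrow> real)"
  shows "integrable \<mu> h"
proof -
  interpret prob_space \<mu> by (rule prob_space_rotation_invariant)
  have "compact (h ` sphere 0 1)"
    using assms by (intro compact_continuous_image) (auto intro: continuous_on_subset)
  then obtain B where "\<And>x. x \<in> sphere 0 1 \<Longrightarrow> norm (h x) \<le> B"
    by (meson bounded_iff compact_imp_bounded image_eqI)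
  moreover have "h \<in> borel_measurable \<mu>"
    unfolding measurable_cong_sets[OF sets_rotation_invariant refl]
    by (intro measurable_restrict_space1 borel_measurable_continuous_onI assms)
  ultimately show ?thesis
    by (intro integrable_const_bound[of _ B]) (auto simp: space_rotation_invariant)
qed

lemma integral_orthogonal_transformation:
  assumes "orthogonal_transformation U" "continuous_on UNIV (h :: real^'n \<Rightarrow> real)"
  shows "integral\<^sup>L \<mu> (\<lambda>x. h (U x)) = integral\<^sup>L \<mu> h"
proof -
  have "U \<in> borel \<rightarrow>\<^sub>M borel"
    using assms(1) by (intro borel_measurable_continuous_onI linear_continuous_on
      linear_linear[THEN iffD1]) (auto simp: orthogonal_transformation_def linear_conv_bounded_linear)
  then have "U \<in> \<mu> \<rightarrow>\<^sub>M \<mu>"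
    unfolding measurable_cong_sets[OF sets_rotation_invariant sets_rotation_invariant]
    using orthogonal_transformation_norm[OF assms(1)]
    by (intro measurable_restrict_space3) auto
  moreover have "h \<in> borel_measurable \<mu>"
    using integrable_rotation_invariant[OF assms(2)] by simp
  ultimately have "integral\<^sup>L (distr \<mu> \<mu> U) h = integral\<^sup>L \<mu> (\<lambda>x. h (U x))"
    by (intro integral_distr)
  then show ?thesis
    using \<mu> assms(1) by (simp add: normalized_rotation_invariant_def)
qed

text \<open>Continuity is part of the induction because it supplies the integrability that splits
  the integral of an average.\<close>

lemma reflection_average_mean:
  assumes "reflection_average h g" "continuous_on UNIV (h :: real^'n \<Rightarrow> real)"
  shows "continuous_on UNIV g \<and> integral\<^sup>L \<mu> g = integral\<^sup>L \<mu> h"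
  using assms(1)
proof induction
  case (step g u)
  have "continuous_on UNIV (reflect u :: real^'n \<Rightarrow> _)"
    using linear_reflect linear_conv_bounded_linear linear_continuous_on by blast
  then have c: "continuous_on UNIV (\<lambda>x. g (reflect u x))"
    using step.IH continuous_on_compose2 by blast
  moreover have "integral\<^sup>L \<mu> (\<lambda>x. (g x + g (reflect u x)) / 2) = integral\<^sup>L \<mu> h"
    using step.IH integral_orthogonal_transformation[OF orthogonal_transformation_reflect[of u], of g]
    by (simp add: integrable_rotation_invariant c)
  ultimately show ?case using step.IH by (auto intro!: continuous_intros)
qed (simp add: assms)

text \<open>Consider the infimum of all upper bounds on the sphere of averages of \<open>h\<close>.
  If it exceeded the mean, an almost optimal average would still take a value at most the mean
  somewhere, and the uniform decrease would push its maximum below the infimum.\<close>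

lemma exists_reflection_average_le_mean:
  assumes L: "\<And>x y. \<bar>h x - h y\<bar> \<le> L * dist x (y::real^'n)" and "\<delta> > 0"
  shows "\<exists>g. reflection_average h g \<and> (\<forall>x\<in>sphere 0 1. g x \<le> integral\<^sup>L \<mu> h + \<delta>)"
proof -
  interpret prob_space \<mu> by (rule prob_space_rotation_invariant)
  \<comment> \<open>\<open>reflection_average_decrease\<close> asks for a positive constant, and
    \<open>L\<close> may be 0.\<close>
  define L' where "L' = max L 1"
  have "L * dist x y \<le> L' * dist x y" for x y :: "real^'n"
    by (intro mult_right_mono) (auto simp: L'_def)
  then have L': "\<bar>h x - h y\<bar> \<le> L' * dist x y" for x y
    using L order_trans by blast
  have lip: "\<bar>g x - g y\<bar> \<le> L' * dist x y" if "reflection_average h g" for g x y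
    using reflection_average_lipschitz[OF that L'] .
  have "L'-lipschitz_on UNIV h"
    using L' by (intro lipschitz_onI) (auto simp: L'_def dist_real_def)
  then have cont: "continuous_on UNIV h"
    by (rule lipschitz_on_continuous_on)
  obtain v :: "real^'n" where v: "norm v = 1" using vector_choose_size[of 1] by auto
  define M where "M = integral\<^sup>L \<mu> h"
  define T where "T = {t. \<exists>g. reflection_average h g \<and> (\<forall>x\<in>sphere 0 1. g x \<le> t)}"
  \<comment> \<open>A function exceeding \<open>M\<close> on the whole sphere would have a mean
    greater than \<open>M\<close>, but averaging keeps the mean equal to \<open>M\<close>.\<close>
  have below: "\<exists>x\<in>sphere 0 1. g x \<le> M" if "reflection_average h g" for g
  proof (rule ccontr)
    assume "\<not> ?thesis"
    then have "AE x in \<mu>. M < g x"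
      by (auto simp: space_rotation_invariant not_le)
    then have "M < integral\<^sup>L \<mu> g"
      using expectation_greater[of g M] reflection_average_mean[OF that cont] integrable_rotation_invariant
      by blast
    then show False using reflection_average_mean[OF that cont] by (simp add: M_def)
  qed
  have bdd: "bdd_below T"
  proof (rule bdd_belowI)
    fix t assume "t \<in> T"
    then obtain g where g: "reflection_average h g" "\<forall>x\<in>sphere 0 1. g x \<le> t"
      by (auto simp: T_def)
    have "integral\<^sup>L \<mu> g \<le> integral\<^sup>L \<mu> (\<lambda>_. t)"
      using g reflection_average_mean[OF g(1) cont]
      by (intro integral_mono) (auto simp: integrable_rotation_invariant space_rotation_invariant)
    then show "M \<le> t"
      using reflection_average_mean[OF g(1) cont] by (simp add: M_def prob_space)
  qed
  have ne: "T \<noteq> {}"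
  proof -
    have "compact (h ` sphere 0 1)"
      using cont by (intro compact_continuous_image) (auto intro: continuous_on_subset)
    then obtain B where "\<forall>y \<in> h ` sphere 0 1. norm y \<le> B"
      using bounded_iff compact_imp_bounded by blast
    then have "B \<in> T"
      unfolding T_def by (auto intro!: exI[of _ h] reflection_average.base)
    then show ?thesis by blast
  qed
  have "Inf T \<le> M"
  proof (rule ccontr)
    assume "\<not> Inf T \<le> M"
    then have w: "Inf T - M > 0" by simp
    have "L' > 0" by (simp add: L'_def)
    from reflection_average_decrease[OF w this, where 'a="real^'n"]
    obtain e where e: "e > 0"
      "\<And>g::real^'n \<Rightarrow> real. \<And>M' x0. (\<And>x y. \<bar>g x - g y\<bar> \<le> L' * dist x y) \<Longrightarrow>
       (\<And>x. x \<in> sphere 0 1 \<Longrightarrow> g x \<le> M') \<Longrightarrow> x0 \<in> sphere 0 1 \<Longrightarrow> g x0 \<le> M' - (Inf T - M) \<Longrightarrow>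
       \<exists>f. reflection_average g f \<and> (\<forall>x\<in>sphere 0 1. f x \<le> M' - e)"
      by blast
    obtain t where t: "t \<in> T" "t < Inf T + e"
      using cInf_lessD[OF ne, of "Inf T + e"] e(1) by auto
    then obtain g where g: "reflection_average h g" "\<And>x. x\<in>sphere 0 1 \<Longrightarrow> g x \<le> t"
      by (auto simp: T_def)
    obtain x0 where x0: "x0 \<in> sphere 0 1" "g x0 \<le> M" using below[OF g(1)] by blast
    \<comment> \<open>Therefore \<open>g x0\<close> is at most \<open>M\<close>, hence at most
      \<open>t - (Inf T - M)\<close>, which is the gap for which \<open>e\<close> was
      chosen.\<close>
    have "Inf T \<le> t" by (rule cInf_lower[OF t(1) bdd])
    then have "\<exists>f. reflection_average g f \<and> (\<forall>x\<in>sphere 0 1. f x \<le> t - e)"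
      using x0 g(2) lip[OF g(1)] by (intro e(2)[of g t x0]) auto
    then have "t - e \<in> T"
      using reflection_average_trans g(1) unfolding T_def by blast
    then have "Inf T \<le> t - e" by (rule cInf_lower[OF _ bdd])
    then show False using t(2) by linarith
  qed
  then obtain t where "t \<in> T" "t < M + \<delta>"
    using cInf_lessD[OF ne, of "M + \<delta>"] \<open>\<delta> > 0\<close> by auto
  then show ?thesis unfolding T_def M_def by fastforce
qed

end

section \<open>Orthogonal invariance and Minkowski symmetrization\<close>

text \<open>Uniqueness of Haar measure: the image measure is translation invariant, and both
  measures agree on the unit ball, which \<open>f\<close> preserves. Computing one double integral
  over \<open>A\<close> and this ball in both orders gives the same product for either measure, and
  the positive finite volume of the ball cancels.\<close>

lemma lborel_distr_orthogonal:
  fixes f :: "'a::euclidean_space \<Rightarrow> 'a"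
  assumes f: "orthogonal_transformation f"
  shows "distr lborel borel f = lborel"
proof (rule measure_eqI)
  let ?M = "distr lborel borel f"
  have lin: "linear f" using f by (simp add: orthogonal_transformation_def)
  then have f_meas [measurable]: "f \<in> borel \<rightarrow>\<^sub>M borel"
    by (intro borel_measurable_continuous_onI linear_continuous_on) (simp add: linear_conv_bounded_linear)
  have shift: "emeasure lborel ((\<lambda>x. x + c) -` A) = emeasure lborel A"
    if "A \<in> sets borel" for A and c :: 'a
    using emeasure_distr[of "(+) c" lborel borel A] that
    by (simp add: lborel_distr_plus add.commute vimage_def)
  have shift': "emeasure ?M ((\<lambda>x. x + c) -` A) = emeasure ?M A" if A: "A \<in> sets borel" for A c
  proof -
    \<comment> \<open>Translating by \<open>c\<close> after \<open>f\<close> is the same as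
      translating by \<open>d\<close> before \<open>f\<close>.\<close>
    obtain d where d: "f d = c"
      using orthogonal_transformation_surj[OF f] by (metis surjD)
    have "(\<lambda>x. x + c) -` A \<in> sets borel" "f -` A \<in> sets borel"
      using A measurable_sets_borel[OF f_meas] measurable_sets_borel[of "\<lambda>x. x + c" borel A] by auto
    then have "emeasure ?M ((\<lambda>x. x + c) -` A) = emeasure lborel ((\<lambda>x. x + d) -` (f -` A))"
      by (simp add: emeasure_distr vimage_def linear_add[OF lin] d)
    also have "\<dots> = emeasure lborel (f -` A)"
      by (rule shift) fact
    finally show ?thesis using A by (simp add: emeasure_distr)
  qed
  let ?B = "ball (0::'a) 1"
  have [measurable]: "?B \<in> sets borel" by simp
  have B: "emeasure ?M {x. y - x \<in> ?B} = emeasure lborel ?B" for y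
  proof -
    have "emeasure ?M {x. y - x \<in> ?B} = emeasure ?M ((\<lambda>x. x + (- y)) -` ?B)"
      by (intro arg_cong[where f="emeasure ?M"]) (auto simp: dist_norm norm_minus_commute)
    also have "\<dots> = emeasure ?M ?B" by (rule shift') simp
    also have "\<dots> = emeasure lborel ?B"
      by (simp add: emeasure_distr) (simp add: vimage_def orthogonal_transformation_norm[OF f] ball_def)
    finally show ?thesis .
  qed
  have Bpos: "emeasure lborel ?B \<noteq> 0" "emeasure lborel ?B \<noteq> \<infinity>"
    using emeasure_lborel_ball_finite[of "0::'a" 1] content_ball_pos[of 1 "0::'a"]
    by (auto simp: measure_def zero_less_measure_iff)
  interpret M: sigma_finite_measure ?M
  proof
    have "emeasure ?M (ball 0 r) \<noteq> \<infinity>" for r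
      using emeasure_lborel_ball_finite[of "0::'a" r]
      by (simp add: emeasure_distr) (simp add: vimage_def orthogonal_transformation_norm[OF f] ball_def)
    moreover have "(\<Union>n. ball (0::'a) (real n)) = UNIV"
      by (auto intro: reals_Archimedean2)
    ultimately show "\<exists>A. countable A \<and> A \<subseteq> sets ?M \<and> \<Union>A = space ?M \<and> (\<forall>a\<in>A. emeasure ?M a \<noteq> \<infinity>)"
      by (intro exI[of _ "range (\<lambda>n. ball 0 (real n))"]) auto
  qed
  interpret P: pair_sigma_finite ?M lborel
    by unfold_locales
  fix A assume "A \<in> sets ?M"
  then have A[measurable]: "A \<in> sets borel" by simp
  have "emeasure ?M A * emeasure lborel ?B = (\<integral>\<^sup>+y. emeasure ?M A * indicator ?B y \<partial>lborel)"
    by (intro nn_integral_cmult_indicator[symmetric]) simp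
  \<comment> \<open>For fixed \<open>y\<close>, translation invariance of the image measure.\<close>
  also have "\<dots> = (\<integral>\<^sup>+y. (\<integral>\<^sup>+x. indicator A (x + y) * indicator ?B y \<partial>?M) \<partial>lborel)"
  proof (intro nn_integral_cong)
    fix y
    have "(\<integral>\<^sup>+x. indicator A (x + y) * indicator ?B y \<partial>?M) =
      (\<integral>\<^sup>+x. indicator ((\<lambda>x. x + y) -` A) x \<partial>?M) * indicator ?B y"
      by (subst nn_integral_multc[symmetric]) (auto simp: indicator_def intro!: nn_integral_cong)
    also have "\<dots> = emeasure ?M A * indicator ?B y"
      using measurable_sets_borel[of "\<lambda>x. x + y" borel A] by (simp add: shift')
    finally show "emeasure ?M A * indicator ?B y = (\<integral>\<^sup>+x. indicator A (x + y) * indicator ?B y \<partial>?M)" ..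
  qed
  also have "\<dots> = (\<integral>\<^sup>+x. (\<integral>\<^sup>+y. indicator A (x + y) * indicator ?B y \<partial>lborel) \<partial>?M)"
    by (rule P.Fubini') measurable
  \<comment> \<open>For fixed \<open>x\<close>, translation invariance of \<open>lborel\<close>.
    Afterwards the image measure only measures a translated unit ball.\<close>
  also have "\<dots> = (\<integral>\<^sup>+x. (\<integral>\<^sup>+y. indicator A y * indicator ?B (y - x) \<partial>lborel) \<partial>?M)"
  proof (rule nn_integral_cong)
    fix x :: 'a
    have "(\<integral>\<^sup>+y. indicator A y * (indicator ?B (y - x) :: ennreal) \<partial>lborel) =
      (\<integral>\<^sup>+y. indicator A y * indicator ?B (y - x) \<partial>distr lborel borel ((+) x))"
      by (simp add: lborel_distr_plus)
    also have "\<dots> = (\<integral>\<^sup>+y. indicator A (x + y) * indicator ?B y \<partial>lborel)"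
      by (subst nn_integral_distr) auto
    finally show "(\<integral>\<^sup>+y. indicator A (x + y) * indicator ?B y \<partial>lborel) =
      (\<integral>\<^sup>+y. indicator A y * indicator ?B (y - x) \<partial>lborel)" by simp
  qed
  also have "\<dots> = (\<integral>\<^sup>+y. (\<integral>\<^sup>+x. indicator A y * indicator ?B (y - x) \<partial>?M) \<partial>lborel)"
    by (rule P.Fubini'[symmetric]) measurable
  also have "\<dots> = (\<integral>\<^sup>+y. indicator A y * emeasure lborel ?B \<partial>lborel)"
  proof (intro nn_integral_cong)
    fix y
    have "(\<integral>\<^sup>+x. indicator ?B (y - x) \<partial>?M) = (\<integral>\<^sup>+x. indicator {x. y - x \<in> ?B} x \<partial>?M)"
      by (intro nn_integral_cong) (simp add: indicator_def)
    also have "\<dots> = emeasure ?M {x. y - x \<in> ?B}"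
      by (intro nn_integral_indicator) simp
    also have "\<dots> = emeasure lborel ?B" by (rule B)
    finally have eq: "(\<integral>\<^sup>+x. indicator ?B (y - x) \<partial>?M) = emeasure lborel ?B" .
    show "(\<integral>\<^sup>+x. indicator A y * indicator ?B (y - x) \<partial>?M) = indicator A y * emeasure lborel ?B"
      unfolding eq[symmetric] by (rule nn_integral_cmult) measurable
  qed
  also have "\<dots> = emeasure lborel A * emeasure lborel ?B"
    by (simp add: nn_integral_multc)
  finally show "emeasure ?M A = emeasure lborel A"
    using Bpos by (simp add: mult.commute[of _ "emeasure lborel ?B"] ennreal_mult_cancel_left)
qed simp

text \<open>Cavalieri's principle. \<open>lborel\<close> is the image of a product measure indexed
  by \<open>Basis\<close>, so the factor of a basis vector \<open>b\<close> can be integrated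
  first.\<close>

lemma emeasure_lborel_le_fibrewise:
  fixes A B :: "'a::euclidean_space set"
  assumes [measurable]: "A \<in> sets borel" "B \<in> sets borel" and b: "b \<in> Basis"
    and le: "\<And>x. emeasure lborel {t. x + t *\<^sub>R b \<in> A} \<le> emeasure lborel {t. x + t *\<^sub>R b \<in> B}"
  shows "emeasure lborel A \<le> emeasure lborel B"
proof -
  interpret product_sigma_finite "\<lambda>_::'a. lborel :: real measure"
    by standard
  let ?I = "Basis - {b}"
  let ?p = "\<lambda>f. \<Sum>c\<in>?I. f c *\<^sub>R c"
  have I: "insert b ?I = Basis" using b by blast
  have eq: "emeasure lborel S =
      (\<integral>\<^sup>+f. emeasure lborel {t. ?p f + t *\<^sub>R b \<in> S} \<partial>(\<Pi>\<^sub>M c\<in>?I. lborel))"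
    if [measurable]: "S \<in> sets borel" for S
  proof -
    have "emeasure lborel S = (\<integral>\<^sup>+x. indicator S x \<partial>lborel)"
      by (simp add: nn_integral_indicator)
    also have "\<dots> = (\<integral>\<^sup>+f. indicator S (\<Sum>c\<in>Basis. f c *\<^sub>R c) \<partial>(\<Pi>\<^sub>M c\<in>Basis. lborel))"
      by (subst lborel_eq, subst nn_integral_distr) auto
    also have "\<dots> = (\<integral>\<^sup>+f. indicator S (\<Sum>c\<in>Basis. f c *\<^sub>R c) \<partial>(\<Pi>\<^sub>M c\<in>insert b ?I. lborel))"
      by (simp only: I)
    also have "\<dots> = (\<integral>\<^sup>+f. (\<integral>\<^sup>+t. indicator S (\<Sum>c\<in>Basis. (f(b := t)) c *\<^sub>R c) \<partial>lborel) \<partial>(\<Pi>\<^sub>M c\<in>?I. lborel))"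
      by (intro product_nn_integral_insert) (auto simp only: I, measurable)
    also have "\<dots> = (\<integral>\<^sup>+f. emeasure lborel {t. ?p f + t *\<^sub>R b \<in> S} \<partial>(\<Pi>\<^sub>M c\<in>?I. lborel))"
    proof (intro nn_integral_cong)
      fix f :: "'a \<Rightarrow> real"
      have "(\<Sum>c\<in>Basis. (f(b := t)) c *\<^sub>R c) = ?p f + t *\<^sub>R b" for t
        using b by (subst sum.remove[of _ b]) (auto intro!: sum.cong)
      moreover have "(\<lambda>t. ?p f + t *\<^sub>R b) -` S \<in> sets borel"
        by (intro measurable_sets_borel[of _ borel]) auto
      ultimately show "(\<integral>\<^sup>+t. indicator S (\<Sum>c\<in>Basis. (f(b := t)) c *\<^sub>R c) \<partial>lborel) =
          emeasure lborel {t. ?p f + t *\<^sub>R b \<in> S}"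
        by (simp add: vimage_def nn_integral_indicator[symmetric] indicator_def of_bool_def)
    qed
    finally show ?thesis .
  qed
  show ?thesis
    unfolding eq[OF assms(1)] eq[OF assms(2)] by (intro nn_integral_mono le)
qed

text \<open>The body (K + R K) / 2 for the reflection R. Its support function is the average of that
  of \<open>K\<close> with its reflection, so it is the counterpart for bodies of one step of
  \<open>reflection_average\<close>.\<close>

definition minkowski_symmetral :: "'a::real_inner \<Rightarrow> 'a set \<Rightarrow> 'a set" where
  "minkowski_symmetral u K = (\<lambda>(x, y). (1 / 2) *\<^sub>R (x + reflect u y)) ` (K \<times> K)"

lemma minkowski_symmetralE:
  assumes "z \<in> minkowski_symmetral u K"
  obtains x y where "x \<in> K" "y \<in> K" "z = (1 / 2) *\<^sub>R (x + reflect u y)"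
proof -
  obtain w where w: "w \<in> K \<times> K" "z = (\<lambda>(x, y). (1 / 2) *\<^sub>R (x + reflect u y)) w"
    using assms unfolding minkowski_symmetral_def by (rule imageE)
  then show ?thesis using that[of "fst w" "snd w"] by (simp add: case_prod_unfold mem_Times_iff)
qed

lemma minkowski_symmetral_scaleR:
  "c \<noteq> 0 \<Longrightarrow> minkowski_symmetral (c *\<^sub>R u) K = minkowski_symmetral u K"
  by (simp add: minkowski_symmetral_def reflect_def)

lemma subset_minkowski_symmetral_0: "K \<subseteq> minkowski_symmetral 0 K"
  unfolding minkowski_symmetral_def by (force simp: scaleR_2[symmetric])

text \<open>Conjugating the reflection in direction \<open>u\<close> by \<open>f\<close> gives the
  reflection in direction \<open>f u\<close>.\<close>

lemma minkowski_symmetral_image: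
  assumes f: "orthogonal_transformation f"
  shows "f ` minkowski_symmetral u K = minkowski_symmetral (f u) (f ` K)"
proof -
  have lin: "linear f" using f by (simp add: orthogonal_transformation_def)
  have "f (reflect u y) = reflect (f u) (f y)" for y
    using f by (simp add: reflect_def linear_diff[OF lin] linear_scale[OF lin] orthogonal_transformation_def)
  then have *: "f ((1/2) *\<^sub>R (x + reflect u y)) = (1/2) *\<^sub>R (f x + reflect (f u) (f y))" for x y
    by (simp add: linear_add[OF lin] linear_scale[OF lin])
  show ?thesis
    unfolding minkowski_symmetral_def by (force simp: * image_iff)
qed

lemma continuous_on_reflect [continuous_intros]:
  fixes f :: "'b::topological_space \<Rightarrow> 'a::real_inner"
  shows "continuous_on S f \<Longrightarrow> continuous_on S (\<lambda>x. reflect u (f x))"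
  unfolding reflect_def divide_inverse by (intro continuous_intros)

lemma compact_minkowski_symmetral:
  "compact K \<Longrightarrow> compact (minkowski_symmetral u K)"
  unfolding minkowski_symmetral_def case_prod_unfold
  by (intro compact_continuous_image compact_Times continuous_intros)

lemma convex_minkowski_symmetral:
  assumes "convex K"
  shows "convex (minkowski_symmetral u K)"
proof -
  have "linear (\<lambda>z. (1 / 2) *\<^sub>R (fst z + reflect u (snd z)))"
    by (intro linearI) (simp_all add: linear_add[OF linear_reflect] linear_scale[OF linear_reflect] algebra_simps)
  then show ?thesis
    unfolding minkowski_symmetral_def case_prod_unfold
    by (intro convex_linear_image convex_Times assms)
qed

text \<open>The fibres of the Steiner symmetral in direction \<open>b\<close> are contained in those of the Minkowski
  symmetral.\<close>

lemma emeasure_le_minkowski_symmetral_Basis: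
  fixes K :: "'a::euclidean_space set"
  assumes K: "compact K" "convex K" and b: "b \<in> Basis"
  shows "emeasure lborel K \<le> emeasure lborel (minkowski_symmetral b K)"
proof (rule emeasure_lborel_le_fibrewise[OF _ _ b])
  show "K \<in> sets borel" "minkowski_symmetral b K \<in> sets borel"
    using K compact_minkowski_symmetral by (auto intro: borel_compact)
  fix x :: 'a
  let ?f = "\<lambda>t::real. x + t *\<^sub>R b"
  let ?I = "{t. ?f t \<in> K}"
  let ?S = "minkowski_symmetral b K"
  show "emeasure lborel ?I \<le> emeasure lborel {t. ?f t \<in> ?S}"
  proof (cases "?I = {}")
    case False
    have "closed (?f -` K)"
      using K by (intro closed_vimage compact_imp_closed) (auto intro!: continuous_intros)
    moreover have "bounded ?I"
    proof -
      obtain r where r: "\<And>y. y \<in> K \<Longrightarrow> norm y \<le> r"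
        using K(1) compact_imp_bounded bounded_iff by metis
      have "norm t \<le> r + norm x" if "t \<in> ?I" for t
      proof -
        have "norm (t *\<^sub>R b) \<le> norm (?f t) + norm x"
          by (metis add_diff_cancel_left' norm_triangle_ineq4)
        then show ?thesis using r[of "?f t"] that b by simp
      qed
      then show ?thesis by (meson bounded_iff)
    qed
    moreover have "convex ?I"
    proof (rule convexI)
      fix s t u v :: real
      assume *: "s \<in> ?I" "t \<in> ?I" "0 \<le> u" "0 \<le> v" "u + v = 1"
      have "?f (u *\<^sub>R s + v *\<^sub>R t) = u *\<^sub>R ?f s + v *\<^sub>R ?f t"
        using *(5) by (simp add: algebra_simps scaleR_add_left[symmetric] del: scaleR_add_left)
      then show "u *\<^sub>R s + v *\<^sub>R t \<in> ?I"
        using convexD[OF K(2) _ _ *(3-5), of "?f s" "?f t"] * by simp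
    qed
    ultimately obtain p q where pq: "?I = {p..q}"
      by (metis compact_eq_bounded_closed connected_compact_interval_1 convex_connected vimage_def)
    then have "p \<le> q" using False by auto
    \<comment> \<open>The point with parameter \<open>t\<close> on the line through \<open>x\<close>
      has \<open>b\<close>-coordinate \<open>t + c\<close>.\<close>
    define c where "c = x \<bullet> b"
    \<comment> \<open>The fibre of the Steiner symmetral: as long as {p..q}, but centred where the
      line meets the hyperplane orthogonal to \<open>b\<close>, at \<open>t = - c\<close>.\<close>
    have "{- (q - p) / 2 - c..(q - p) / 2 - c} \<subseteq> {t. ?f t \<in> ?S}"
    proof
      fix t assume t: "t \<in> {- (q - p) / 2 - c..(q - p) / 2 - c}"
      \<comment> \<open>Reflection turns the parameter \<open>s\<close> into
        \<open>- s - 2 * c\<close>, so the midpoint has parameter \<open>(r - s) / 2 - c\<close>,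
        which equals \<open>t\<close>. Placing \<open>r\<close> and \<open>s\<close> symmetrically
        about \<open>(p + q) / 2\<close> keeps both in the fibre.\<close>
      define r s where "r = (p + q) / 2 + (t + c)" and "s = (p + q) / 2 - (t + c)"
      have "r \<in> {p..q}" "s \<in> {p..q}"
        using t by (auto simp: r_def s_def field_simps)
      then have "?f r \<in> K" "?f s \<in> K" using pq by auto
      moreover have "(1/2) *\<^sub>R (?f r + reflect b (?f s)) = ?f t"
      proof -
        have eq: "reflect b (?f s) = x - (s + 2 * c) *\<^sub>R b"
          using b by (simp add: reflect_def c_def inner_add_left algebra_simps)
            (simp flip: scaleR_add_left)
        have "(1/2) *\<^sub>R (?f r + reflect b (?f s)) = (1/2) *\<^sub>R (2 *\<^sub>R x + (r - s - 2 * c) *\<^sub>R b)"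
          unfolding eq by (simp add: algebra_simps scaleR_2)
        also have "r - s - 2 * c = 2 * t" by (simp add: r_def s_def)
        finally show ?thesis by (simp add: algebra_simps)
      qed
      ultimately show "t \<in> {t. ?f t \<in> ?S}"
        unfolding minkowski_symmetral_def by force
    qed
    moreover have "{t. ?f t \<in> ?S} \<in> sets borel"
      using compact_minkowski_symmetral[OF K(1), of b]
      by (intro borel_closed closed_vimage[unfolded vimage_def] compact_imp_closed)
        (auto intro!: continuous_intros)
    ultimately have "emeasure lborel {- (q - p) / 2 - c..(q - p) / 2 - c} \<le> emeasure lborel {t. ?f t \<in> ?S}"
      by (intro emeasure_mono) auto
    then show ?thesis
      using pq \<open>p \<le> q\<close> by (simp add: emeasure_lborel_Icc_eq diff_divide_distrib)
  qed simp
qed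

lemma emeasure_orthogonal_image:
  fixes f :: "'a::euclidean_space \<Rightarrow> 'a"
  assumes f: "orthogonal_transformation f" and K: "compact K"
  shows "emeasure lborel (f ` K) = emeasure lborel K"
proof -
  have "linear f" using f by (simp add: orthogonal_transformation_def)
  then have c: "continuous_on A f" for A
    using linear_continuous_on by (auto simp: linear_conv_bounded_linear)
  have "f ` K \<in> sets borel"
    by (intro borel_compact compact_continuous_image c K)
  then have "emeasure lborel (f ` K) = emeasure lborel (f -` (f ` K))"
    using lborel_distr_orthogonal[OF f] emeasure_distr[of f lborel borel "f ` K"] c
      borel_measurable_continuous_onI[OF c] by simp
  then show ?thesis
    using orthogonal_transformation_inj[OF f] by (simp add: inj_vimage_image_eq)
qed

text \<open>A reflection taking the normalized \<open>u\<close> to a basis vector preserves volumes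
  and commutes with symmetrization up to the change of direction, which leaves the case of a basis
  vector.\<close>

lemma emeasure_le_minkowski_symmetral:
  fixes K :: "'a::euclidean_space set"
  assumes K: "compact K" "convex K"
  shows "emeasure lborel K \<le> emeasure lborel (minkowski_symmetral u K)"
proof (cases "u = 0")
  case True
  then show ?thesis
    using subset_minkowski_symmetral_0 compact_minkowski_symmetral[OF K(1)]
    by (auto intro!: emeasure_mono borel_compact)
next
  case False
  obtain b :: 'a where b: "b \<in> Basis" using nonempty_Basis by blast
  define f where "f = reflect ((1 / norm u) *\<^sub>R u - b)"
  have f: "orthogonal_transformation f"
    unfolding f_def by (rule orthogonal_transformation_reflect)
  have "f ((1 / norm u) *\<^sub>R u) = b"
    unfolding f_def using False b by (intro reflect_swap) simp
  then have fu: "(1 / norm u) *\<^sub>R f u = b"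
    using f by (simp add: orthogonal_transformation_def linear_scale)
  have "compact (f ` K)" "convex (f ` K)"
    using f K by (auto simp: f_def intro!: compact_continuous_image convex_linear_image continuous_intros linear_reflect)
  then have "emeasure lborel (f ` K) \<le> emeasure lborel (minkowski_symmetral b (f ` K))"
    using b by (rule emeasure_le_minkowski_symmetral_Basis)
  also have "minkowski_symmetral b (f ` K) = f ` minkowski_symmetral u K"
    unfolding minkowski_symmetral_image[OF f] fu[symmetric] using False by (intro minkowski_symmetral_scaleR) simp
  finally show ?thesis
    by (simp add: emeasure_orthogonal_image[OF f] K compact_minkowski_symmetral)
qed

text \<open>Each averaging step is matched by a Minkowski symmetral of the body. Reflections are
  self-adjoint, so the inner product of \<open>(x + R y) / 2\<close> with \<open>u\<close> is the
  average of those of \<open>x\<close> with \<open>u\<close> and of \<open>y\<close> with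
  \<open>R u\<close>. Tracking a majorant of the support function keeps suprema out of the
  induction.\<close>

lemma reflection_average_dominating_body:
  fixes K :: "'a::euclidean_space set"
  assumes "reflection_average h g" "compact K" "convex K" "\<And>x u. x \<in> K \<Longrightarrow> x \<bullet> u \<le> h u"
  shows "\<exists>K'. compact K' \<and> convex K' \<and> emeasure lborel K \<le> emeasure lborel K' \<and>
    (\<forall>x\<in>K'. \<forall>u. x \<bullet> u \<le> g u)"
  using assms(1)
proof induction
  case base
  then show ?case using assms by blast
next
  case (step g v)
  then obtain K' where K': "compact K'" "convex K'" "emeasure lborel K \<le> emeasure lborel K'"
    "\<And>x u. x \<in> K' \<Longrightarrow> x \<bullet> u \<le> g u" by blast
  have "z \<bullet> u \<le> (g u + g (reflect v u)) / 2" if z: "z \<in> minkowski_symmetral v K'" for z u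
  proof -
    obtain x y where xy: "x \<in> K'" "y \<in> K'" "z = (1/2) *\<^sub>R (x + reflect v y)"
      using z by (rule minkowski_symmetralE)
    then show ?thesis
      using K'(4)[OF xy(1), of u] K'(4)[OF xy(2), of "reflect v u"]
      by (simp add: inner_add_left inner_reflect_left)
  qed
  then show ?case
    using K' emeasure_le_minkowski_symmetral[OF K'(1,2), of v]
    by (intro exI[of _ "minkowski_symmetral v K'"])
      (auto simp: compact_minkowski_symmetral convex_minkowski_symmetral)
qed

section \<open>Norms and the volumes of their unit balls\<close>

text \<open>A predicate, because the norms induced by X and Y live on a type that carries the
  Euclidean norm as its own. Nonnegativity follows from homogeneity and the triangle
  inequality.\<close>

definition is_norm :: "('a::real_vector \<Rightarrow> real) \<Rightarrow> bool" where
  "is_norm N \<longleftrightarrow> (\<forall>x y. N (x + y) \<le> N x + N y) \<and> (\<forall>c x. N (c *\<^sub>R x) = \<bar>c\<bar> * N x) \<and>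
     (\<forall>x. N x = 0 \<longrightarrow> x = 0)"

lemma is_normD:
  assumes "is_norm N"
  shows is_norm_triangle: "N (x + y) \<le> N x + N y"
    and is_norm_scaleR: "N (c *\<^sub>R x) = \<bar>c\<bar> * N x"
    and is_norm_eq_0: "N x = 0 \<longleftrightarrow> x = 0"
proof -
  show scale: "N (c *\<^sub>R x) = \<bar>c\<bar> * N x" for c x
    using assms by (simp add: is_norm_def)
  have "N 0 = 0" using scale[of 0 0] by simp
  then show "N x = 0 \<longleftrightarrow> x = 0"
    using assms by (auto simp: is_norm_def)
qed (use assms in \<open>simp add: is_norm_def\<close>)

lemma is_norm_0:
  assumes "is_norm N"
  shows "N 0 = 0"
  using is_norm_eq_0[OF assms] by simp

lemma is_norm_minus:
  assumes "is_norm N"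
  shows "N (- x) = N x"
  using is_norm_scaleR[OF assms, of "-1" x] by simp

lemma is_norm_nonneg:
  assumes "is_norm N"
  shows "N x \<ge> 0"
  using is_norm_triangle[OF assms, of x "- x"] is_norm_0[OF assms] is_norm_minus[OF assms, of x]
  by simp

lemma is_norm_diff_le:
  assumes "is_norm N"
  shows "\<bar>N x - N y\<bar> \<le> N (x - y)"
  using is_norm_triangle[OF assms, of "x - y" y] is_norm_triangle[OF assms, of "y - x" x]
    is_norm_minus[OF assms, of "x - y"] by simp

lemma is_norm_sum_le:
  assumes "is_norm N" "finite S"
  shows "N (sum f S) \<le> (\<Sum>i\<in>S. N (f i))"
  using assms(2)
proof induction
  case (insert i S)
  then show ?case using is_norm_triangle[OF assms(1), of "f i" "sum f S"] by simp
qed (simp add: is_norm_0[OF assms(1)])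

lemma is_norm_le_norm:
  fixes N :: "'a::euclidean_space \<Rightarrow> real"
  assumes "is_norm N"
  shows "N x \<le> (\<Sum>b\<in>Basis. N b) * norm x"
proof -
  have "N x = N (\<Sum>b\<in>Basis. (x \<bullet> b) *\<^sub>R b)"
    by (simp add: euclidean_representation)
  also have "\<dots> \<le> (\<Sum>b\<in>Basis. N ((x \<bullet> b) *\<^sub>R b))"
    by (rule is_norm_sum_le[OF assms]) simp
  also have "\<dots> \<le> (\<Sum>b\<in>Basis. norm x * N b)"
    by (intro sum_mono) (auto simp: is_norm_scaleR[OF assms] is_norm_nonneg[OF assms] Basis_le_norm
        intro!: mult_right_mono)
  finally show ?thesis by (simp add: sum_distrib_left mult.commute)
qed

lemma is_norm_lipschitz:
  fixes N :: "'a::euclidean_space \<Rightarrow> real"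
  assumes "is_norm N"
  shows "\<bar>N x - N y\<bar> \<le> (\<Sum>b\<in>Basis. N b) * dist x y"
  using is_norm_diff_le[OF assms, of x y] is_norm_le_norm[OF assms, of "x - y"]
  by (simp add: dist_norm)

lemma is_norm_continuous:
  fixes N :: "'a::euclidean_space \<Rightarrow> real"
  assumes "is_norm N"
  shows "continuous_on A N"
proof -
  have "(\<Sum>b\<in>Basis. N b)-lipschitz_on A N"
    using is_norm_lipschitz[OF assms]
    by (intro lipschitz_onI) (auto simp: dist_real_def sum_nonneg is_norm_nonneg[OF assms])
  then show ?thesis by (rule lipschitz_on_continuous_on)
qed

text \<open>The minimum over the Euclidean sphere is attained and positive. This bounds the balls of
  \<open>N\<close> and makes them compact.\<close>

lemma is_norm_ge_norm:
  fixes N :: "'a::euclidean_space \<Rightarrow> real"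
  assumes N: "is_norm N"
  obtains c where "c > 0" "\<And>x. c * norm x \<le> N x"
proof -
  have "sphere (0::'a) 1 \<noteq> {}" by simp
  then obtain x0 where x0: "x0 \<in> sphere 0 1" "\<And>x. x \<in> sphere 0 1 \<Longrightarrow> N x0 \<le> N x"
    using continuous_attains_inf[OF compact_sphere _ is_norm_continuous[OF N]] by metis
  show ?thesis
  proof (rule that)
    have "x0 \<noteq> 0" using x0(1) by auto
    then show "N x0 > 0" using is_norm_eq_0[OF N] is_norm_nonneg[OF N, of x0] by fastforce
    show "N x0 * norm x \<le> N x" for x
    proof (cases "x = 0")
      case False
      then have "N x0 \<le> N ((1 / norm x) *\<^sub>R x)" by (intro x0) simp
      then show ?thesis using False by (simp add: is_norm_scaleR[OF N] field_simps)
    qed (simp add: is_norm_0[OF N])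
  qed
qed

lemma is_norm_compact:
  fixes N :: "'a::euclidean_space \<Rightarrow> real"
  assumes N: "is_norm N"
  shows "compact {x. N x \<le> r}"
proof -
  obtain c where c: "c > 0" "\<And>x. c * norm x \<le> N x" using is_norm_ge_norm[OF N] by blast
  have "norm x \<le> r / c" if "N x \<le> r" for x
    using c(1) order_trans[OF c(2) that] by (simp add: field_simps)
  then have "bounded {x. N x \<le> r}" by (auto simp: bounded_iff)
  moreover have "closed {x. N x \<le> r}"
    using is_norm_continuous[OF N, of UNIV] by (intro closed_Collect_le) auto
  ultimately show ?thesis by (simp add: compact_eq_bounded_closed)
qed

lemma is_norm_convex:
  assumes N: "is_norm N"
  shows "convex {x. N x \<le> r}"
proof (rule convexI)
  fix x y and u v :: real
  assume *: "x \<in> {x. N x \<le> r}" "y \<in> {x. N x \<le> r}" "0 \<le> u" "0 \<le> v" "u + v = 1"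
  have "N (u *\<^sub>R x + v *\<^sub>R y) \<le> u * N x + v * N y"
    using is_norm_triangle[OF N, of "u *\<^sub>R x" "v *\<^sub>R y"] * by (simp add: is_norm_scaleR[OF N])
  also have "\<dots> \<le> r"
    using convex_bound_le[of "N x" r "N y" u v] * by simp
  finally show "u *\<^sub>R x + v *\<^sub>R y \<in> {x. N x \<le> r}" by simp
qed

lemma is_norm_ball_scale:
  assumes N: "is_norm N" and "r > 0"
  shows "{x. N x \<le> r} = (*\<^sub>R) r ` {x. N x \<le> 1}"
proof (intro set_eqI iffI)
  fix x assume "x \<in> {x. N x \<le> r}"
  then have "N ((1 / r) *\<^sub>R x) \<le> 1" "x = r *\<^sub>R ((1 / r) *\<^sub>R x)"
    using assms by (auto simp: is_norm_scaleR[OF N])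
  then show "x \<in> (*\<^sub>R) r ` {x. N x \<le> 1}" by blast
qed (use assms in \<open>auto simp: is_norm_scaleR[OF N]\<close>)

lemma emeasure_lborel_scaleR_compact:
  fixes S :: "'a::euclidean_space set"
  assumes "compact S"
  shows "emeasure lborel ((\<lambda>x. r *\<^sub>R x + a) ` S) = ennreal (\<bar>r\<bar> ^ DIM('a)) * emeasure lborel S"
proof -
  have "compact ((\<lambda>x. r *\<^sub>R x + a) ` S)"
    using assms by (intro compact_continuous_image) (auto intro!: continuous_intros)
  then show ?thesis
    using emeasure_lebesgue_affine[of r a S] assms
    by (simp add: emeasure_completion borel_compact ennreal_power)
qed

lemma emeasure_is_norm_ball:
  fixes N :: "'a::euclidean_space \<Rightarrow> real"
  assumes N: "is_norm N" and "r > 0"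
  shows "emeasure lborel {x. N x \<le> r} = ennreal (r ^ DIM('a)) * emeasure lborel {x. N x \<le> 1}"
  using emeasure_lborel_scaleR_compact[OF is_norm_compact[OF N, of 1], of r 0] \<open>r > 0\<close>
  by (simp add: is_norm_ball_scale[OF assms])

lemma is_norm_norm: "is_norm norm"
  by (simp add: is_norm_def norm_triangle_ineq)

lemma is_norm_reflection_average:
  assumes "reflection_average N g" "is_norm N"
  shows "is_norm g"
  using assms(1)
proof induction
  case (step g u)
  note g = step.IH
  show ?case
    unfolding is_norm_def
  proof (intro conjI allI impI)
    fix x y :: 'a and c :: real
    show "(g (x + y) + g (reflect u (x + y))) / 2 \<le>
        (g x + g (reflect u x)) / 2 + (g y + g (reflect u y)) / 2"
      using is_norm_triangle[OF g, of x y] is_norm_triangle[OF g, of "reflect u x" "reflect u y"]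
      unfolding linear_add[OF linear_reflect] by argo
    show "(g (c *\<^sub>R x) + g (reflect u (c *\<^sub>R x))) / 2 = \<bar>c\<bar> * ((g x + g (reflect u x)) / 2)"
      by (simp add: linear_scale[OF linear_reflect] is_norm_scaleR[OF g] algebra_simps add_divide_distrib)
    assume "(g x + g (reflect u x)) / 2 = 0"
    then have "g x = 0"
      using is_norm_nonneg[OF g, of x] is_norm_nonneg[OF g, of "reflect u x"] by simp
    then show "x = 0" using is_norm_eq_0[OF g] by simp
  qed
qed (rule assms)

text \<open>Layer cake: the integral of a truncated cone over a unit ball is a fixed multiple of the
  volume of that ball. Unlike the volume, it is visibly convex in the norm.\<close>

lemma nn_integral_cone:
  fixes N :: "'a::euclidean_space \<Rightarrow> real"
  assumes N: "is_norm N"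
  shows "(\<integral>\<^sup>+x. ennreal (max 0 (1 - N x)) \<partial>lborel) =
    (\<integral>\<^sup>+t. ennreal (t ^ DIM('a)) * indicator {0<..1} t \<partial>lborel) * emeasure lborel {x. N x \<le> 1}"
proof -
  have [measurable]: "N \<in> borel_measurable borel"
    by (rule borel_measurable_continuous_onI[OF is_norm_continuous[OF N]])
  have "(\<integral>\<^sup>+x. ennreal (max 0 (1 - N x)) \<partial>lborel) =
      (\<integral>\<^sup>+x. (\<integral>\<^sup>+t. indicator {t. N x \<le> t \<and> 0 < t \<and> t \<le> 1} t \<partial>lborel) \<partial>lborel)"
  \<comment> \<open>The height of the cone at \<open>x\<close> is the length of the set of levels
    \<open>t\<close> in (0, 1] with \<open>N x \<le> t\<close>. Level 0 is left out since
    \<open>emeasure_is_norm_ball\<close> scales by positive radii.\<close>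
  proof (rule nn_integral_cong)
    fix x
    have "emeasure lborel {t. N x \<le> t \<and> 0 < t \<and> t \<le> 1} = ennreal (max 0 (1 - N x))"
    proof (cases "N x > 0")
      case True
      then have "{t. N x \<le> t \<and> 0 < t \<and> t \<le> 1} = {N x..1}" by auto
      then show ?thesis by (simp add: emeasure_lborel_Icc_eq max_def)
    next
      case False
      then have "{t. N x \<le> t \<and> 0 < t \<and> t \<le> 1} = {0<..1}" "N x = 0"
        using is_norm_nonneg[OF N, of x] by auto
      then show ?thesis by simp
    qed
    then show "ennreal (max 0 (1 - N x)) = (\<integral>\<^sup>+t. indicator {t. N x \<le> t \<and> 0 < t \<and> t \<le> 1} t \<partial>lborel)"
      by (subst nn_integral_indicator) auto
  qed
  also have "\<dots> = (\<integral>\<^sup>+x. (\<integral>\<^sup>+t. indicator {x. N x \<le> t} x * indicator {0<..1} t \<partial>lborel) \<partial>lborel)"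
    by (intro nn_integral_cong) (auto simp: indicator_def)
  also have "\<dots> = (\<integral>\<^sup>+t. (\<integral>\<^sup>+x. indicator {x. N x \<le> t} x * indicator {0<..1} t \<partial>lborel) \<partial>lborel)"
    unfolding indicator_def by (rule lborel_pair.Fubini'[symmetric]) measurable
  also have "\<dots> = (\<integral>\<^sup>+t. ennreal (t ^ DIM('a)) * indicator {0<..1} t * emeasure lborel {x. N x \<le> 1} \<partial>lborel)"
  proof (rule nn_integral_cong)
    fix t :: real
    have "(\<integral>\<^sup>+x. indicator {x. N x \<le> t} x * indicator {0<..1} t \<partial>lborel) =
        emeasure lborel {x. N x \<le> t} * indicator {0<..1} t"
      by (subst nn_integral_multc) auto
    then show "(\<integral>\<^sup>+x. indicator {x. N x \<le> t} x * indicator {0<..1} t \<partial>lborel) =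
        ennreal (t ^ DIM('a)) * indicator {0<..1} t * emeasure lborel {x. N x \<le> 1}"
      using emeasure_is_norm_ball[OF N, of t] by (auto simp: indicator_def)
  qed
  finally show ?thesis by (simp add: nn_integral_multc)
qed

text \<open>The integral is 1 / (n + 1); being positive and finite is what lets it be
  cancelled.\<close>

lemma cone_constant:
  "(\<integral>\<^sup>+t. ennreal (t ^ n) * indicator {0<..1::real} t \<partial>lborel) \<noteq> 0"
  "(\<integral>\<^sup>+t. ennreal (t ^ n) * indicator {0<..1::real} t \<partial>lborel) \<noteq> \<infinity>"
proof -
  have "ennreal ((1/2) ^ n) * emeasure lborel {1/2..1::real} =
      (\<integral>\<^sup>+t. ennreal ((1/2) ^ n) * indicator {1/2..1::real} t \<partial>lborel)"
    by (intro nn_integral_cmult_indicator[symmetric]) simp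
  also have "\<dots> \<le> (\<integral>\<^sup>+t. ennreal (t ^ n) * indicator {0<..1::real} t \<partial>lborel)"
    by (intro nn_integral_mono) (auto simp: indicator_def intro!: ennreal_leI power_mono)
  finally show "(\<integral>\<^sup>+t. ennreal (t ^ n) * indicator {0<..1::real} t \<partial>lborel) \<noteq> 0"
    by (auto simp: ennreal_mult[symmetric])
  have "(\<integral>\<^sup>+t. ennreal (t ^ n) * indicator {0<..1::real} t \<partial>lborel) \<le>
      (\<integral>\<^sup>+t. indicator {0<..1::real} t \<partial>lborel)"
    by (intro nn_integral_mono) (auto simp: indicator_def power_le_one)
  then show "(\<integral>\<^sup>+t. ennreal (t ^ n) * indicator {0<..1::real} t \<partial>lborel) \<noteq> \<infinity>"
    by (auto simp: top_unique)
qed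

text \<open>Since \<open>max 0 (1 - s)\<close> is convex in \<open>s\<close>, the cone over an
  average lies below the average of the two cones. The reflected cone has the same integral, and
  cone integrals are proportional to volumes.\<close>

lemma emeasure_ball_reflection_average_le:
  fixes N :: "'a::euclidean_space \<Rightarrow> real"
  assumes "reflection_average N g" and N: "is_norm N"
  shows "emeasure lborel {x. g x \<le> 1} \<le> emeasure lborel {x. N x \<le> 1}"
proof -
  define I where "I g = (\<integral>\<^sup>+x. ennreal (max 0 (1 - g x)) \<partial>lborel)" for g :: "'a \<Rightarrow> real"
  have "I g \<le> I N"
    using assms(1)
  proof induction
    case (step g u)
    have "is_norm g" by (rule is_norm_reflection_average) fact+
    then have [measurable]: "g \<in> borel_measurable borel"
      by (intro borel_measurable_continuous_onI is_norm_continuous)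
    have [measurable]: "(reflect u :: 'a \<Rightarrow> 'a) \<in> borel \<rightarrow>\<^sub>M borel"
      by (intro borel_measurable_continuous_onI continuous_intros)
    have "I (\<lambda>x. (g x + g (reflect u x)) / 2) \<le>
        (\<integral>\<^sup>+x. ennreal (1/2) * (ennreal (max 0 (1 - g x)) + ennreal (max 0 (1 - g (reflect u x)))) \<partial>lborel)"
      unfolding I_def
    proof (intro nn_integral_mono)
      fix x
      have "ennreal (max 0 (1 - (g x + g (reflect u x)) / 2)) \<le>
          ennreal (1/2 * (max 0 (1 - g x) + max 0 (1 - g (reflect u x))))"
        by (intro ennreal_leI) (simp add: max_def field_simps)
      also have "\<dots> = ennreal (1/2) * (ennreal (max 0 (1 - g x)) + ennreal (max 0 (1 - g (reflect u x))))"
        by (subst ennreal_mult) (simp_all add: add_nonneg_nonneg flip: ennreal_plus)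
      finally show "ennreal (max 0 (1 - (g x + g (reflect u x)) / 2)) \<le> \<dots>" .
    qed
    also have "\<dots> = ennreal (1/2) * (I g + (\<integral>\<^sup>+x. ennreal (max 0 (1 - g (reflect u x))) \<partial>lborel))"
      by (simp add: nn_integral_cmult nn_integral_add I_def)
    also have "(\<integral>\<^sup>+x. ennreal (max 0 (1 - g (reflect u x))) \<partial>lborel) =
        (\<integral>\<^sup>+x. ennreal (max 0 (1 - g x)) \<partial>distr lborel borel (reflect u))"
      by (subst nn_integral_distr) auto
    also have "\<dots> = I g"
      by (simp add: lborel_distr_orthogonal[OF orthogonal_transformation_reflect] I_def)
    also have "ennreal (1/2) * (I g + I g) = ennreal (1/2) * ennreal 2 * I g"
      by (simp only: mult_2[symmetric] mult.assoc ennreal_numeral)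
    also have "ennreal (1/2) * ennreal 2 = 1"
      by (subst ennreal_mult[symmetric]) simp_all
    also have "1 * I g = I g" by simp
    finally show ?case using step.IH by (rule order_trans)
  qed simp
  moreover have "is_norm g" using assms by (rule is_norm_reflection_average)
  ultimately show ?thesis
    unfolding I_def nn_integral_cone[OF N] nn_integral_cone[OF \<open>is_norm g\<close>]
    using cone_constant[of "DIM('a)"] by (simp add: ennreal_mult_le_mult_iff)
qed

section \<open>Volumes and Levy means\<close>

lemma emeasure_lborel_compact:
  fixes S :: "'a::euclidean_space set"
  assumes "compact S"
  shows "emeasure lborel S = ennreal (measure lborel S)"
  using emeasure_bounded_finite[OF compact_imp_bounded[OF assms]]
  by (intro emeasure_eq_ennreal_measure) auto

lemma measure_lborel_le_iff:
  fixes S :: "'a::euclidean_space set" and T :: "'b::euclidean_space set"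
  assumes "compact S" "compact T" "c \<ge> 0"
  shows "emeasure lborel S \<le> ennreal c * emeasure lborel T \<longleftrightarrow> measure lborel S \<le> c * measure lborel T"
  using assms by (simp add: emeasure_lborel_compact flip: ennreal_mult)

lemma measure_lborel_scaleR_compact:
  fixes S :: "'a::euclidean_space set"
  assumes "compact S"
  shows "measure lborel ((\<lambda>x. r *\<^sub>R x + a) ` S) = \<bar>r\<bar> ^ DIM('a) * measure lborel S"
proof -
  have "compact ((\<lambda>x. r *\<^sub>R x + a) ` S)"
    using assms by (intro compact_continuous_image) (auto intro!: continuous_intros)
  then show ?thesis
    using emeasure_lborel_scaleR_compact[OF assms, of r a] assms
    by (simp add: emeasure_lborel_compact flip: ennreal_mult)
qed

lemma le_power_mult_limit:
  fixes a b c :: real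
  assumes "\<And>\<delta>. \<delta> > 0 \<Longrightarrow> a \<le> (c + \<delta>) ^ n * b"
  shows "a \<le> c ^ n * b"
proof (rule tendsto_lowerbound)
  have "((\<lambda>\<delta>. (c + \<delta>) ^ n * b) \<longlongrightarrow> (c + 0) ^ n * b) (at_right 0)"
    by (intro tendsto_intros)
  then show "((\<lambda>\<delta>. (c + \<delta>) ^ n * b) \<longlongrightarrow> c ^ n * b) (at_right 0)" by simp
  show "\<forall>\<^sub>F \<delta> in at_right 0. a \<le> (c + \<delta>) ^ n * b"
    using assms by (auto intro: eventually_at_rightI[of 0 1])
qed simp

section \<open>Dual norms\<close>

context
  fixes N :: "real^'n \<Rightarrow> real"
  assumes N: "is_norm N"
begin

text \<open>Shows that the supremum in \<open>dual_norm\<close> is over a set bounded above, as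
  \<open>SUP\<close> on the reals is unspecified otherwise. It also supplies a common Lipschitz
  constant.\<close>

lemma is_norm_inner_bound:
  obtains R where "\<And>x y. N y \<le> 1 \<Longrightarrow> \<bar>x \<bullet> y\<bar> \<le> R * norm x"
proof -
  obtain R where R: "\<And>y. N y \<le> 1 \<Longrightarrow> norm y \<le> R"
    using compact_imp_bounded[OF is_norm_compact[OF N, of 1]] by (auto simp: bounded_iff)
  have "\<bar>x \<bullet> y\<bar> \<le> R * norm x" if "N y \<le> 1" for x y
    using Cauchy_Schwarz_ineq2[of x y] mult_left_mono[OF R[OF that], of "norm x"]
    by (simp add: mult.commute)
  then show ?thesis by (rule that)
qed

lemma dual_norm_ge:
  assumes "N x \<le> 1"
  shows "\<bar>u \<bullet> x\<bar> \<le> dual_norm N u"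
proof -
  obtain R where "\<And>x y. N y \<le> 1 \<Longrightarrow> \<bar>x \<bullet> y\<bar> \<le> R * norm x"
    using is_norm_inner_bound by blast
  then have "bdd_above ((\<lambda>y. \<bar>u \<bullet> y\<bar>) ` {y. N y \<le> 1})"
    by (auto intro!: bdd_aboveI)
  then show ?thesis
    unfolding dual_norm_def using assms by (intro cSUP_upper) auto
qed

lemma dual_norm_nonneg: "0 \<le> dual_norm N u"
  using dual_norm_ge[of 0 u] by (simp add: is_norm_0[OF N])

lemma dual_norm_lipschitz:
  obtains R where "\<And>u v. \<bar>dual_norm N u - dual_norm N v\<bar> \<le> R * dist u v"
proof -
  obtain R where R: "\<And>x y. N y \<le> 1 \<Longrightarrow> \<bar>x \<bullet> y\<bar> \<le> R * norm x"
    using is_norm_inner_bound by blast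
  have diff: "dual_norm N u \<le> dual_norm N v + R * dist u v" for u v
    unfolding dual_norm_def[of N u]
  proof (rule cSUP_least)
    have "N 0 \<le> 1" by (simp add: is_norm_0[OF N])
    then show "{y. N y \<le> 1} \<noteq> {}" by blast
    fix y assume "y \<in> {y. N y \<le> 1}"
    then have y: "N y \<le> 1" by simp
    have "\<bar>u \<bullet> y\<bar> \<le> \<bar>v \<bullet> y\<bar> + \<bar>(u - v) \<bullet> y\<bar>" by (simp add: inner_diff_left)
    also have "\<dots> \<le> dual_norm N v + R * dist u v"
      using dual_norm_ge[OF y, of v] R[OF y, of "u - v"] by (simp add: dist_norm)
    finally show "\<bar>u \<bullet> y\<bar> \<le> dual_norm N v + R * dist u v" .
  qed
  have "\<bar>dual_norm N u - dual_norm N v\<bar> \<le> R * dist u v" for u v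
    using diff[of u v] diff[of v u] by (simp add: dist_commute)
  then show ?thesis by (rule that)
qed

end

section \<open>Bounding volumes of unit balls by Levy means\<close>

context
  fixes \<mu> :: "(real^'n) measure"
  assumes \<mu>: "normalized_rotation_invariant \<mu>"
begin

text \<open>For an average \<open>g\<close> of \<open>N\<close> that is at most \<open>c\<close> on
  the sphere, the Euclidean ball lies in the \<open>g\<close>-ball of radius \<open>c\<close>, and
  the unit ball of \<open>g\<close> has at most the volume of that of \<open>N\<close>.\<close>

lemma measure_cball_le_mean_norm:
  assumes N: "is_norm (N :: real^'n \<Rightarrow> real)"
  shows "measure lborel (cball (0::real^'n) 1) \<le> levy_mean \<mu> N ^ CARD('n) * measure lborel {x. N x \<le> 1}"
proof (rule le_power_mult_limit)
  fix \<delta> :: real assume "\<delta> > 0"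
  obtain g where g: "reflection_average N g" "\<And>x. x \<in> sphere 0 1 \<Longrightarrow> g x \<le> levy_mean \<mu> N + \<delta>"
    using exists_reflection_average_le_mean[OF \<mu> is_norm_lipschitz[OF N] \<open>\<delta> > 0\<close>]
    unfolding levy_mean_def by blast
  define c where "c = levy_mean \<mu> N + \<delta>"
  have "levy_mean \<mu> N \<ge> 0"
    unfolding levy_mean_def by (intro integral_nonneg_AE) (simp add: is_norm_nonneg[OF N])
  then have "c > 0" using \<open>\<delta> > 0\<close> by (simp add: c_def)
  have "is_norm g" using g(1) N by (rule is_norm_reflection_average)
  have le: "g x \<le> c * norm x" for x
  proof (cases "x = 0")
    case False
    then have "g ((1 / norm x) *\<^sub>R x) \<le> c" unfolding c_def by (intro g) simp
    then show ?thesis using False by (simp add: is_norm_scaleR[OF \<open>is_norm g\<close>] field_simps)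
  qed (simp add: is_norm_0[OF \<open>is_norm g\<close>])
  have "g x \<le> c" if "norm x \<le> 1" for x
    using le[of x] mult_left_le[OF that, of c] \<open>c > 0\<close> by linarith
  then have "cball 0 1 \<subseteq> {x. g x \<le> c}" by auto
  then have "emeasure lborel (cball (0::real^'n) 1) \<le> emeasure lborel {x. g x \<le> c}"
    using is_norm_compact[OF \<open>is_norm g\<close>] by (intro emeasure_mono) (auto intro: borel_compact)
  also have "\<dots> = ennreal (c ^ CARD('n)) * emeasure lborel {x. g x \<le> 1}"
    using emeasure_is_norm_ball[OF \<open>is_norm g\<close> \<open>c > 0\<close>] by simp
  also have "\<dots> \<le> ennreal (c ^ CARD('n)) * emeasure lborel {x. N x \<le> 1}"
    by (intro mult_left_mono emeasure_ball_reflection_average_le g N) simp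
  finally show "measure lborel (cball (0::real^'n) 1) \<le> (levy_mean \<mu> N + \<delta>) ^ CARD('n) * measure lborel {x. N x \<le> 1}"
    using \<open>c > 0\<close> unfolding c_def[symmetric] by (subst (asm) measure_lborel_le_iff) (auto simp: is_norm_compact[OF N])
qed

text \<open>Urysohn's inequality, with \<open>h\<close> bounding the support function of \<open>K\<close>.\<close>

lemma measure_le_mean_width:
  fixes K :: "(real^'n) set"
  assumes K: "compact K" "convex K" and h: "\<And>x u. x \<in> K \<Longrightarrow> x \<bullet> u \<le> h u" "\<And>u. h u \<ge> 0"
    and L: "\<And>x y. \<bar>h x - h y\<bar> \<le> L * dist x y"
  shows "measure lborel K \<le> levy_mean \<mu> h ^ CARD('n) * measure lborel (cball (0::real^'n) 1)"
proof (rule le_power_mult_limit)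
  fix \<delta> :: real assume "\<delta> > 0"
  obtain g where g: "reflection_average h g" "\<And>x. x \<in> sphere 0 1 \<Longrightarrow> g x \<le> levy_mean \<mu> h + \<delta>"
    using exists_reflection_average_le_mean[OF \<mu> L \<open>\<delta> > 0\<close>]
    unfolding levy_mean_def by blast
  define c where "c = levy_mean \<mu> h + \<delta>"
  have "levy_mean \<mu> h \<ge> 0"
    unfolding levy_mean_def by (intro integral_nonneg_AE) (simp add: h)
  then have "c > 0" using \<open>\<delta> > 0\<close> by (simp add: c_def)
  obtain K' where K': "compact K'" "emeasure lborel K \<le> emeasure lborel K'"
    "\<And>x u. x \<in> K' \<Longrightarrow> x \<bullet> u \<le> g u"
    using reflection_average_dominating_body[OF g(1) K h(1)] by blast
  have "norm x \<le> c" if "x \<in> K'" for x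
  proof (cases "x = 0")
    case False
    \<comment> \<open>Testing the domination by \<open>g\<close> in the direction of
      \<open>x\<close> itself places \<open>K'\<close> in the Euclidean ball of radius
      \<open>c\<close>.\<close>
    have "norm x = x \<bullet> ((1 / norm x) *\<^sub>R x)"
      using False by (simp add: power2_norm_eq_inner[symmetric] power2_eq_square)
    also have "\<dots> \<le> g ((1 / norm x) *\<^sub>R x)" using K'(3)[OF that] .
    also have "\<dots> \<le> c" unfolding c_def using False by (intro g) simp
    finally show ?thesis .
  qed (use \<open>c > 0\<close> in simp)
  then have "K' \<subseteq> {x. norm x \<le> c}" by blast
  then have "emeasure lborel K' \<le> emeasure lborel {x::real^'n. norm x \<le> c}"
    using is_norm_compact[OF is_norm_norm, of c] by (intro emeasure_mono) (auto intro: borel_compact)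
  also have "\<dots> = ennreal (c ^ CARD('n)) * emeasure lborel {x::real^'n. norm x \<le> 1}"
    using emeasure_is_norm_ball[OF is_norm_norm \<open>c > 0\<close>, where 'a = "real^'n"] by simp
  also have "{x::real^'n. norm x \<le> 1} = cball 0 1" by auto
  finally have "emeasure lborel K \<le> ennreal (c ^ CARD('n)) * emeasure lborel (cball (0::real^'n) 1)"
    using K'(2) by (rule order_trans[rotated])
  then show "measure lborel K \<le> (levy_mean \<mu> h + \<delta>) ^ CARD('n) * measure lborel (cball (0::real^'n) 1)"
    using \<open>c > 0\<close> unfolding c_def[symmetric] by (subst (asm) measure_lborel_le_iff) (auto simp: K)
qed

text \<open>The unit ball of \<open>N\<close> is symmetric, so \<open>dual_norm N\<close> is its
  support function and Urysohn's inequality applies.\<close>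

lemma measure_le_mean_dual_norm:
  assumes N: "is_norm (N :: real^'n \<Rightarrow> real)"
  shows "measure lborel {x. N x \<le> 1} \<le> levy_mean \<mu> (dual_norm N) ^ CARD('n) * measure lborel (cball (0::real^'n) 1)"
proof -
  obtain R where "\<And>u v. \<bar>dual_norm N u - dual_norm N v\<bar> \<le> R * dist u v"
    using dual_norm_lipschitz[OF N] by blast
  then show ?thesis
    using dual_norm_ge[OF N] dual_norm_nonneg[OF N]
    by (intro measure_le_mean_width[OF is_norm_compact[OF N] is_norm_convex[OF N]])
      (auto simp: inner_commute intro: order_trans[OF abs_ge_self])
qed

end

lemma measure_diagonal_image:
  fixes S :: "(real^'n) set" and A :: "real^'n^'n"
  assumes S: "compact S" and A: "\<And>i k. i \<noteq> k \<Longrightarrow> A $ i $ k = 0"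
    and "det A \<noteq> 0"
  shows "measure lborel ((*v) A ` S) = \<bar>det A\<bar> * measure lborel S"
proof -
  have det: "det A = (\<Prod>i\<in>UNIV. A $ i $ i)"
    by (rule det_diagonal) (rule A)
  define c where "c b = (A *v b) \<bullet> b" for b
  have Basis: "Basis = range (\<lambda>i::'n. axis i (1::real))"
    by (auto simp: Basis_vec_def)
  have comp: "(A *v x) $ i = A $ i $ i * x $ i" for x i
  proof -
    have "(A *v x) $ i = (\<Sum>k\<in>UNIV. if k = i then A $ i $ i * x $ i else 0)"
      unfolding matrix_vector_mult_def vec_lambda_beta by (intro sum.cong) (auto simp: A)
    then show ?thesis by simp
  qed
  have c: "c (axis i 1) = A $ i $ i" for i
    by (simp add: c_def inner_axis comp)
  have nz: "c j \<noteq> 0" if "j \<in> Basis" for j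
    using that \<open>det A \<noteq> 0\<close> by (auto simp: Basis c det)
  \<comment> \<open>Brings \<open>A\<close> into the coordinatewise form of
    \<open>lborel_affine_euclidean\<close>, with \<open>c b\<close> as the factor along
    \<open>b\<close> and translation part 0.\<close>
  have T: "0 + (\<Sum>j\<in>Basis. (c j * (x \<bullet> j)) *\<^sub>R j) = A *v x" for x
  proof (rule euclidean_eqI)
    fix b :: "real^'n" assume b: "b \<in> Basis"
    then obtain i where i: "b = axis i 1" by (auto simp: Basis)
    have "(0 + (\<Sum>j\<in>Basis. (c j * (x \<bullet> j)) *\<^sub>R j)) \<bullet> b = c b * (x \<bullet> b)"
      using b by (simp add: inner_sum_left inner_Basis if_distrib cong: if_cong)
    also have "\<dots> = (A *v x) \<bullet> b"
      by (simp add: i c inner_axis comp)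
    finally show "(0 + (\<Sum>j\<in>Basis. (c j * (x \<bullet> j)) *\<^sub>R j)) \<bullet> b = (A *v x) \<bullet> b" .
  qed
  have prod: "(\<Prod>j\<in>Basis. \<bar>c j\<bar>) = \<bar>det A\<bar>"
    unfolding Basis by (subst prod.reindex) (auto simp: inj_on_def axis_eq_axis c det abs_prod)
  have [measurable]: "(*v) A \<in> borel \<rightarrow>\<^sub>M borel"
    by (intro borel_measurable_continuous_onI matrix_vector_mult_linear_continuous_on)
  have comp': "compact ((*v) A ` S)"
    by (intro compact_continuous_image S matrix_vector_mult_linear_continuous_on)
  then have [measurable]: "(*v) A ` S \<in> sets borel" by (rule borel_compact)
  have "inj ((*v) A)"
    using \<open>det A \<noteq> 0\<close> by (simp add: inj_matrix_vector_mult invertible_det_nz)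
  have "emeasure lborel ((*v) A ` S) =
      emeasure (density (distr lborel borel ((*v) A)) (\<lambda>_. \<Prod>j\<in>Basis. \<bar>c j\<bar>)) ((*v) A ` S)"
    using lborel_affine_euclidean[of c 0, OF nz, unfolded T] by simp
  also have "\<dots> = ennreal \<bar>det A\<bar> * emeasure lborel ((*v) A -` ((*v) A ` S))"
    unfolding prod by (simp add: emeasure_density_const emeasure_distr)
  also have "(*v) A -` ((*v) A ` S) = S"
    using \<open>inj ((*v) A)\<close> by (rule inj_vimage_image_eq)
  finally show ?thesis
    by (simp add: emeasure_lborel_compact S comp' flip: ennreal_mult)
qed

text \<open>The covering sets are controlled by their \<open>N\<close>-diameter alone, because they
  will be traces of balls whose centres may lie outside the subspace. Any point of such a set serves
  as the centre of a translate of the \<open>N\<close>-ball of radius \<open>e\<close> containing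
  it.\<close>

lemma covering_volume:
  fixes A :: "real^'n^'n"
  assumes M: "is_norm M" and N: "is_norm N" and "e > 0"
    and A: "\<And>i k. i \<noteq> k \<Longrightarrow> A $ i $ k = 0" and "finite I"
    and cov: "(*v) A ` {x. M x \<le> 1} \<subseteq> (\<Union>i\<in>I. S i)"
    and diam: "\<And>i x y. i \<in> I \<Longrightarrow> x \<in> S i \<Longrightarrow> y \<in> S i \<Longrightarrow> N (x - y) \<le> e"
  shows "\<bar>det A\<bar> * measure lborel {x. M x \<le> 1} \<le> card I * (e ^ CARD('n) * measure lborel {x. N x \<le> 1})"
proof -
  show ?thesis
  proof (cases "det A = 0")
    case False
    \<comment> \<open>For empty \<open>S i\<close> the point is arbitrary, and its inclusion in
      \<open>C i\<close> is trivial.\<close>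
    define a where "a i = (SOME x. x \<in> S i)" for i
    define C where "C i = (\<lambda>x. e *\<^sub>R x + a i) ` {x. N x \<le> 1}" for i
    have "S i \<subseteq> C i" if "i \<in> I" for i
    proof
      fix x assume x: "x \<in> S i"
      then have "a i \<in> S i" unfolding a_def by (rule someI)
      then have "N ((1 / e) *\<^sub>R (x - a i)) \<le> 1"
        using diam[OF that x] \<open>e > 0\<close> by (simp add: is_norm_scaleR[OF N])
      moreover have "x = e *\<^sub>R ((1 / e) *\<^sub>R (x - a i)) + a i"
        using \<open>e > 0\<close> by simp
      ultimately show "x \<in> C i" unfolding C_def by blast
    qed
    then have sub: "(*v) A ` {x. M x \<le> 1} \<subseteq> (\<Union>i\<in>I. C i)" using cov by blast
    have C: "compact (C i)" "measure lborel (C i) = e ^ CARD('n) * measure lborel {x. N x \<le> 1}" for i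
      unfolding C_def using measure_lborel_scaleR_compact[OF is_norm_compact[OF N], of e "a i" 1] \<open>e > 0\<close>
      by (auto intro!: compact_continuous_image continuous_intros is_norm_compact[OF N])
    have fin: "C i \<in> fmeasurable lborel" for i
      using C(1)[of i] by (rule fmeasurable_compact)
    have "\<bar>det A\<bar> * measure lborel {x. M x \<le> 1} = measure lborel ((*v) A ` {x. M x \<le> 1})"
      by (rule measure_diagonal_image[symmetric]) (auto simp: A False is_norm_compact[OF M])
    also have "\<dots> \<le> measure lborel (\<Union>i\<in>I. C i)"
    proof (rule measure_mono_fmeasurable[OF sub])
      have "compact ((*v) A ` {x. M x \<le> 1})"
        by (intro compact_continuous_image is_norm_compact[OF M] matrix_vector_mult_linear_continuous_on)
      then show "(*v) A ` {x. M x \<le> 1} \<in> sets lborel" by (simp add: borel_compact)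
      show "(\<Union>i\<in>I. C i) \<in> fmeasurable lborel" using fin \<open>finite I\<close> by (intro fmeasurable.finite_UN) auto
    qed
    also have "\<dots> \<le> (\<Sum>i\<in>I. measure lborel (C i))"
      using \<open>finite I\<close> by (intro measure_UNION_le) (use fmeasurableD[OF fin] in simp_all)
    also have "\<dots> = card I * (e ^ CARD('n) * measure lborel {x. N x \<le> 1})"
      by (simp add: C(2))
    finally show ?thesis .
  qed (use \<open>e > 0\<close> in simp)
qed

section \<open>Multipliers and entropy numbers\<close>

lemma sum_fun_apply: "sum f S x = (\<Sum>i\<in>S. f i x)"
  by (induction S rule: infinite_finite_induct) auto

text \<open>Integrate against \<open>\<xi> (e k)\<close>. The combination vanishes almost everywhere
  only, which is what \<open>cls f = 0\<close> yields in a Banach function space.\<close>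

lemma orthonormal_L2_coefficients_0:
  fixes \<alpha> :: "'i \<Rightarrow> real"
  assumes \<xi>: "orthonormal_L2 \<nu> \<xi>" and "finite I" and e: "inj_on e I" "\<And>i. i \<in> I \<Longrightarrow> e i \<ge> 1"
    and 0: "AE x in \<nu>. (\<Sum>i\<in>I. \<alpha> i * \<xi> (e i) x) = 0" and "k \<in> I"
  shows "\<alpha> k = 0"
proof -
  have int: "integrable \<nu> (\<lambda>x. \<xi> (e i) x * \<xi> (e k) x)" if "i \<in> I" for i
  proof (rule Bochner_Integration.integrable_bound)
    have m: "\<xi> (e i) \<in> borel_measurable \<nu>" "integrable \<nu> (\<lambda>x. (\<xi> (e i) x)\<^sup>2)" if "i \<in> I" for i
      using \<xi> e(2)[OF that] by (auto simp: orthonormal_L2_def)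
    show "integrable \<nu> (\<lambda>x. (\<xi> (e i) x)\<^sup>2 + (\<xi> (e k) x)\<^sup>2)"
      using m \<open>i \<in> I\<close> \<open>k \<in> I\<close> by simp
    show "(\<lambda>x. \<xi> (e i) x * \<xi> (e k) x) \<in> borel_measurable \<nu>"
      using m \<open>i \<in> I\<close> \<open>k \<in> I\<close> by simp
    have "\<bar>a * b\<bar> \<le> a\<^sup>2 + b\<^sup>2" for a b :: real
      using sum_squares_bound[of "\<bar>a\<bar>" "\<bar>b\<bar>"] mult_nonneg_nonneg[OF abs_ge_zero abs_ge_zero, of a b]
      unfolding abs_mult power2_abs by linarith
    then show "AE x in \<nu>. norm (\<xi> (e i) x * \<xi> (e k) x) \<le> norm ((\<xi> (e i) x)\<^sup>2 + (\<xi> (e k) x)\<^sup>2)"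
      by simp
  qed
  have "0 = (\<integral>x. (\<Sum>i\<in>I. \<alpha> i * \<xi> (e i) x) * \<xi> (e k) x \<partial>\<nu>)"
    using 0 by (intro integral_eq_zero_AE[symmetric]) auto
  also have "\<dots> = (\<integral>x. (\<Sum>i\<in>I. \<alpha> i * (\<xi> (e i) x * \<xi> (e k) x)) \<partial>\<nu>)"
    by (simp add: sum_distrib_right mult.assoc)
  also have "\<dots> = (\<Sum>i\<in>I. \<alpha> i * (\<integral>x. \<xi> (e i) x * \<xi> (e k) x \<partial>\<nu>))"
    using int by (subst Bochner_Integration.integral_sum) auto
  also have "\<dots> = (\<Sum>i\<in>I. if i = k then \<alpha> i else 0)"
    using \<xi> e \<open>k \<in> I\<close> by (intro sum.cong) (auto simp: orthonormal_L2_def inj_on_def)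
  also have "\<dots> = \<alpha> k" using \<open>finite I\<close> \<open>k \<in> I\<close> by simp
  finally show ?thesis by simp
qed

section \<open>Coordinates and norms on the span of the chosen blocks\<close>

lemma banach_function_space_sum:
  assumes "banach_function_space \<nu> F cls" "finite S" "\<And>i. i \<in> S \<Longrightarrow> f i \<in> F"
  shows "sum f S \<in> F \<and> cls (sum f S) = (\<Sum>i\<in>S. cls (f i))"
  using assms(2,3)
proof (induction S rule: finite_induct)
  case empty
  have "(0 :: 'a \<Rightarrow> real) \<in> F \<and> cls 0 = 0"
    using assms(1) by (simp add: banach_function_space_def)
  then show ?case unfolding sum.empty .
next
  case (insert i S)
  then have IH: "sum f S \<in> F" "cls (sum f S) = (\<Sum>i\<in>S. cls (f i))" and "f i \<in> F"
    by auto
  then have "f i + sum f S \<in> F" "cls (f i + sum f S) = cls (f i) + cls (sum f S)"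
    using assms(1) fun_space.subspace_add unfolding banach_function_space_def by blast+
  then show ?case unfolding sum.insert[OF insert.hyps] IH(2) by (rule conjI)
qed

lemma banach_function_space_coord_iso:
  assumes F: "banach_function_space \<nu> F cls" and \<eta>: "\<And>i. \<eta> (num i) \<in> F"
  shows "coord_iso num \<eta> \<alpha> \<in> F" (is ?m)
    and "cls (coord_iso num \<eta> \<alpha>) = (\<Sum>i\<in>UNIV. (\<alpha> $ i) *\<^sub>R cls (\<eta> (num i)))" (is ?e)
proof -
  have scale: "fscale c (\<eta> (num i)) \<in> F" "cls (fscale c (\<eta> (num i))) = c *\<^sub>R cls (\<eta> (num i))" for c i
    using F \<eta> fun_space.subspace_scale by (auto simp: banach_function_space_def)
  show ?m ?e
    using banach_function_space_sum[OF F, of UNIV "\<lambda>i. fscale (\<alpha> $ i) (\<eta> (num i))"] scale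
    by (auto simp: coord_iso_def)
qed

text \<open>Definiteness is where orthonormality enters; \<open>e\<close> identifies the enumerated
  functions as distinct members of the orthonormal system.\<close>

lemma is_norm_coord_iso:
  fixes num :: "'n::finite \<Rightarrow> nat"
  assumes F: "banach_function_space \<nu> F cls" and \<eta>: "\<And>i. \<eta> (num i) \<in> F"
    and \<xi>: "orthonormal_L2 \<nu> \<xi>" and e: "inj e" "\<And>i. e i \<ge> 1" "\<And>i. \<eta> (num i) = \<xi> (e i)"
  shows "is_norm (\<lambda>\<alpha>. norm (cls (coord_iso num \<eta> \<alpha>)))"
proof -
  note cls = banach_function_space_coord_iso[where num = num and \<eta> = \<eta>, OF F \<eta>]
  have "\<alpha> = 0" if "norm (cls (coord_iso num \<eta> \<alpha>)) = 0" for \<alpha>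
  proof -
    have "AE x in \<nu>. coord_iso num \<eta> \<alpha> x = 0"
      using F cls(1) that by (auto simp: banach_function_space_def)
    then have "AE x in \<nu>. (\<Sum>i\<in>UNIV. \<alpha> $ i * \<xi> (e i) x) = 0"
      by (simp add: coord_iso_def sum_fun_apply fscale_def e(3))
    then have "\<alpha> $ i = 0" for i
      using e by (intro orthonormal_L2_coefficients_0[OF \<xi>, of UNIV e]) auto
    then show ?thesis by (simp add: vec_eq_iff)
  qed
  moreover have "norm (cls (coord_iso num \<eta> (\<alpha> + \<beta>))) \<le>
      norm (cls (coord_iso num \<eta> \<alpha>)) + norm (cls (coord_iso num \<eta> \<beta>))" for \<alpha> \<beta>
    unfolding cls(2) by (simp add: scaleR_add_left sum.distrib norm_triangle_ineq)
  moreover have "norm (cls (coord_iso num \<eta> (c *\<^sub>R \<alpha>))) = \<bar>c\<bar> * norm (cls (coord_iso num \<eta> \<alpha>))" for c \<alpha>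
    unfolding cls(2) by (simp flip: scaleR_scaleR scaleR_sum_right)
  ultimately show ?thesis by (auto simp: is_norm_def)
qed

lemma block_enumeration_block_of:
  assumes \<eta>: "block_enumeration \<xi> \<kappa> j m n \<eta>" and i: "i \<in> {1..n}"
  shows "block_of \<kappa> j i \<in> {1..m}" and "\<eta> i \<in> block \<xi> \<kappa> (j (block_of \<kappa> j i))"
proof -
  \<comment> \<open>The \<open>LEAST\<close> in \<open>block_of\<close> needs a witness. Counting
    shows that \<open>n\<close> is at most the sum of all block sizes, so \<open>s = m\<close> is
    one.\<close>
  have "n = card (\<Union>s\<in>{1..m}. \<xi> ` block_idx \<kappa> (j s))"
    using \<eta> bij_betw_same_card unfolding block_enumeration_def by fastforce
  also have "\<dots> \<le> (\<Sum>s\<in>{1..m}. card (\<xi> ` block_idx \<kappa> (j s)))"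
    by (rule card_UN_le) simp
  also have "\<dots> \<le> block_end \<kappa> j m"
    unfolding block_end_def block_dim_def
    by (intro sum_mono order_trans[OF card_image_le]) (auto simp: block_idx_def)
  finally have "i \<le> block_end \<kappa> j m" using i by simp
  define s where "s = block_of \<kappa> j i"
  have le: "i \<le> block_end \<kappa> j s"
    unfolding s_def block_of_def by (rule LeastI) fact
  have "s \<le> m"
    unfolding s_def block_of_def by (rule Least_le) fact
  \<comment> \<open>The partial sum at 0 is 0, whereas \<open>i\<close> is at least 1.\<close>
  have "s \<noteq> 0"
    using le i by (cases "s = 0") (auto simp: block_end_def)
  then show s: "block_of \<kappa> j i \<in> {1..m}" using \<open>s \<le> m\<close> by (simp add: s_def)
  have "\<not> i \<le> block_end \<kappa> j (s - 1)"
    using \<open>s \<noteq> 0\<close> unfolding s_def block_of_def by (intro not_less_Least) simp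
  then have "\<eta> i \<in> \<eta> ` {block_end \<kappa> j (s - 1) + 1..block_end \<kappa> j s}"
    using le by auto
  then have "\<eta> i \<in> fun_space.span (\<eta> ` {block_end \<kappa> j (s - 1) + 1..block_end \<kappa> j s})"
    by (rule fun_space.span_base)
  then show "\<eta> i \<in> block \<xi> \<kappa> (j (block_of \<kappa> j i))"
    using \<eta> s unfolding block_enumeration_def s_def by blast
qed

text \<open>Orthonormality speaks of indices from 1 on; monotonicity of \<kappa> and
  \<open>\<kappa> 1 = 1\<close> keep every block in that range.\<close>

lemma block_enumeration_index:
  assumes \<eta>: "block_enumeration \<xi> \<kappa> j m n \<eta>"
    and \<kappa>: "\<kappa> 1 = 1" "strict_mono_on {1..} \<kappa>" and j: "\<And>s. s \<in> {1..m} \<Longrightarrow> j s \<ge> 1"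
    and i: "i \<in> {1..n}"
  shows "\<exists>e\<ge>1. \<eta> i = \<xi> e"
proof -
  have "\<eta> ` {1..n} = (\<Union>s\<in>{1..m}. \<xi> ` block_idx \<kappa> (j s))"
    using \<eta> unfolding block_enumeration_def bij_betw_def by blast
  then have "\<eta> i \<in> (\<Union>s\<in>{1..m}. \<xi> ` block_idx \<kappa> (j s))"
    using i by blast
  then obtain s e where se: "s \<in> {1..m}" "e \<in> block_idx \<kappa> (j s)" "\<eta> i = \<xi> e"
    by blast
  have "\<kappa> 1 \<le> \<kappa> (j s)"
    using strict_mono_on_leD[OF \<kappa>(2), of 1 "j s"] j[OF se(1)] by simp
  then show ?thesis
    using se \<kappa>(1) by (intro exI[of _ e]) (auto simp: block_idx_def)
qed

lemma cover_exponent_bound: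
  fixes d c \<epsilon> :: real
  assumes "n \<ge> 1" "c > 0" "\<epsilon> > 0" "0 \<le> d" and le: "d \<le> 2 ^ (k - 1) * (2 * \<epsilon> * c) ^ n"
  shows "2 powr (- 1 - real k / real n) * (d powr (1 / real n) / c) \<le> \<epsilon>"
proof -
  \<comment> \<open>Here 2^(k-1) is relaxed to 2^k, giving the exponent -k/n of the stated
    constant.\<close>
  have "d \<le> 2 ^ k * (2 * \<epsilon> * c) ^ n"
    using assms by (elim order_trans) (intro mult_right_mono power_increasing, auto)
  then have "d powr (1 / real n) \<le> (2 ^ k * (2 * \<epsilon> * c) ^ n) powr (1 / real n)"
    using assms by (intro powr_mono2) auto
  also have "\<dots> = 2 powr (real k / real n) * (2 * \<epsilon> * c)"
    using assms by (simp add: powr_mult powr_powr flip: powr_realpow)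
  finally have "2 powr (- 1 - real k / real n) * (d powr (1 / real n) / c) \<le>
      2 powr (- 1 - real k / real n) * (2 powr (real k / real n) * (2 * \<epsilon> * c) / c)"
    using assms by (intro mult_left_mono divide_right_mono) auto
  also have "\<dots> = (2 powr (- 1 - real k / real n) * 2 powr (real k / real n)) * (2 * \<epsilon>)"
    using assms by simp
  also have "2 powr (- 1 - real k / real n) * 2 powr (real k / real n) = 1 / 2"
    by (simp flip: powr_add)
  finally show ?thesis by simp
qed

theorem theorem3p3:
  fixes \<Omega> :: "(real^'s) set" and \<nu> :: "(real^'s) measure"
    and \<xi> :: "nat \<Rightarrow> real^'s \<Rightarrow> real" and \<kappa> :: "nat \<Rightarrow> nat"
    and m :: nat and j :: "nat \<Rightarrow> nat"
    and FX FY :: "(real^'s \<Rightarrow> real) set"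
    and clsX :: "(real^'s \<Rightarrow> real) \<Rightarrow> 'x::banach"
    and clsY :: "(real^'s \<Rightarrow> real) \<Rightarrow> 'y::banach"
    and \<Lambda> :: "'x \<Rightarrow> 'y" and lam :: "nat \<Rightarrow> real"
    and \<eta> :: "nat \<Rightarrow> real^'s \<Rightarrow> real"
    and num :: "'n::finite \<Rightarrow> nat" and \<mu> :: "(real^'n) measure"
    and k :: nat
  assumes "class_K \<Omega> \<nu> \<xi> \<kappa>"
    and "m \<ge> 1" and "\<And>s. s \<in> {1..m} \<Longrightarrow> j s \<ge> 1" and "inj_on j {1..m}"
    and "CARD('n) = fun_space.dim (blocks_span \<xi> \<kappa> j m)"
    and "banach_function_space \<nu> FX clsX" and "blocks_span \<xi> \<kappa> j m \<subseteq> FX"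
    and "banach_function_space \<nu> FY clsY" and "blocks_span \<xi> \<kappa> j m \<subseteq> FY"
    and "multiplier_operator \<xi> FX clsX FY clsY \<Lambda>" and "compact_operator \<Lambda>"
    and "\<And>s. s \<in> {1..m} \<Longrightarrow> acts_as_scalar clsX FY clsY \<Lambda> (block \<xi> \<kappa> (j s)) (lam s)"
    and "block_enumeration \<xi> \<kappa> j m CARD('n) \<eta>"
    and "bij_betw num UNIV {1..CARD('n)}"
    and "normalized_rotation_invariant \<mu>"
    and "k \<ge> 1"
  shows "entropy_number k (\<Lambda> ` cball 0 1) \<ge>
    2 powr (- 1 - real k / real CARD('n)) *
    (\<bar>det (multiplier_matrix num \<kappa> j lam :: real^'n^'n)\<bar> powr (1 / real CARD('n)) /
      (levy_mean \<mu> (\<lambda>\<alpha>. norm (clsX (coord_iso num \<eta> \<alpha>))) *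
       levy_mean \<mu> (dual_norm (\<lambda>\<alpha>. norm (clsY (coord_iso num \<eta> \<alpha>))))))"
proof -
  have \<xi>: "orthonormal_L2 \<nu> \<xi>" and \<kappa>: "\<kappa> 1 = 1" "strict_mono_on {1..} \<kappa>"
    using assms(1) by (auto simp: class_K_def)
  have num: "num i \<in> {1..CARD('n)}" for i
    using assms(14) by (auto simp: bij_betw_def)
  have "\<exists>e\<ge>1. \<eta> (num i) = \<xi> e" for i
    by (rule block_enumeration_index[OF assms(13) \<kappa> assms(3) num])
  then obtain e where e: "\<And>i. e i \<ge> 1" "\<And>i. \<eta> (num i) = \<xi> (e i)"
    by metis
  have "inj e"
  proof (rule injI)
    fix a b assume "e a = e b"
    then have "\<eta> (num a) = \<eta> (num b)" by (simp add: e)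
    then have "num a = num b"
      using assms(13) num by (auto simp: block_enumeration_def bij_betw_def dest: inj_onD)
    then show "a = b" using assms(14) by (auto simp: bij_betw_def dest: injD)
  qed
  let ?s = "\<lambda>i. block_of \<kappa> j (num i)"
  have s: "?s i \<in> {1..m}" "\<eta> (num i) \<in> block \<xi> \<kappa> (j (?s i))" for i
    using block_enumeration_block_of[OF assms(13) num] by auto
  have \<eta>: "\<eta> (num i) \<in> blocks_span \<xi> \<kappa> j m" for i
    unfolding blocks_span_def using s by (intro fun_space.span_base) blast
  have \<eta>X: "\<eta> (num i) \<in> FX" and \<eta>Y: "\<eta> (num i) \<in> FY" for i
    using \<eta> assms(7,9) by auto
  define NX where "NX = (\<lambda>\<alpha>::real^'n. norm (clsX (coord_iso num \<eta> \<alpha>)))"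
  define NY where "NY = (\<lambda>\<alpha>::real^'n. norm (clsY (coord_iso num \<eta> \<alpha>)))"
  have NX: "is_norm NX"
    unfolding NX_def by (rule is_norm_coord_iso[OF assms(6) \<eta>X \<xi> \<open>inj e\<close> e])
  have NY: "is_norm NY"
    unfolding NY_def by (rule is_norm_coord_iso[OF assms(8) \<eta>Y \<xi> \<open>inj e\<close> e])
  note clsX = banach_function_space_coord_iso(2)[where num = num and \<eta> = \<eta>, OF assms(6) \<eta>X]
  note clsY = banach_function_space_coord_iso(2)[where num = num and \<eta> = \<eta>, OF assms(8) \<eta>Y]
  define A :: "real^'n^'n" where "A = multiplier_matrix num \<kappa> j lam"
  have A_mult: "(A *v \<alpha>) $ i = lam (?s i) * \<alpha> $ i" for \<alpha> i
  proof -
    have "(A *v \<alpha>) $ i = (\<Sum>i'\<in>UNIV. if i' = i then lam (?s i) * \<alpha> $ i else 0)"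
      unfolding A_def multiplier_matrix_def matrix_vector_mult_def vec_lambda_beta
      by (intro sum.cong) auto
    then show ?thesis by simp
  qed
  have lin: "linear \<Lambda>"
    using assms(10) by (simp add: multiplier_operator_def)
  \<comment> \<open>The basis function numbered \<open>num i\<close> lies in block
    \<open>?s i\<close>, on which the operator multiplies by \<open>lam (?s i)\<close>.\<close>
  have "\<Lambda> (clsX (\<eta> (num i))) = lam (?s i) *\<^sub>R clsY (\<eta> (num i))" for i
    using assms(12)[OF s(1)] s(2) assms(8) \<eta>Y unfolding acts_as_scalar_def banach_function_space_def by metis
  then have \<Lambda>: "\<Lambda> (clsX (coord_iso num \<eta> \<alpha>)) = clsY (coord_iso num \<eta> (A *v \<alpha>))" for \<alpha>
    unfolding clsX clsY by (simp add: linear_sum[OF lin] linear_scale[OF lin] A_mult mult.commute)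
  define MX where "MX = levy_mean \<mu> NX"
  define MY where "MY = levy_mean \<mu> (dual_norm NY)"
  have M: "MX \<ge> 0" "MY \<ge> 0"
    unfolding MX_def MY_def levy_mean_def
    by (auto intro!: integral_nonneg_AE simp: is_norm_nonneg[OF NX] dual_norm_nonneg[OF NY])
  have bound: "2 powr (- 1 - real k / real CARD('n)) * (\<bar>det A\<bar> powr (1 / real CARD('n)) / (MX * MY)) \<le> \<epsilon>"
    if "\<epsilon> > 0" and y: "\<Lambda> ` cball 0 1 \<subseteq> (\<Union>i\<in>{1..2 ^ (k - 1)}. cball (y i) \<epsilon>)" for \<epsilon> and y :: "nat \<Rightarrow> 'y"
  \<comment> \<open>If the product of the means is 0, the quotient is 0 by convention and the bound
    is immediate.\<close>
  proof (cases "MX * MY = 0")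
    case False
    then have pos: "MX * MY > 0" using M by (simp add: less_le)
    let ?v = "measure lborel (cball (0::real^'n) 1)"
    let ?vX = "measure lborel {\<alpha>. NX \<alpha> \<le> 1}"
    let ?vY = "measure lborel {\<alpha>. NY \<alpha> \<le> 1}"
    let ?n = "CARD('n)"
    have v: "?v > 0"
      using content_cball_pos[of 1 "0::real^'n"] by simp
    have "\<bar>det A\<bar> * ?vX \<le> card {1..2 ^ (k - 1) :: nat} * ((2 * \<epsilon>) ^ ?n * ?vY)"
    proof (rule covering_volume[OF NX NY])
      show "A $ i $ i' = 0" if "i \<noteq> i'" for i i'
        using that by (simp add: A_def multiplier_matrix_def)
      \<comment> \<open>The covering sets are the coefficient vectors mapped into one ball of Y. The
        centre \<open>y i\<close> may lie outside the range of the coordinate map, so two such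
        vectors are compared through it, at \<open>NY\<close>-distance at most 2 \<epsilon>.\<close>
      show "(*v) A ` {\<alpha>. NX \<alpha> \<le> 1} \<subseteq> (\<Union>i\<in>{1..2 ^ (k - 1)}. {\<beta>. clsY (coord_iso num \<eta> \<beta>) \<in> cball (y i) \<epsilon>})"
        using y by (auto simp: NX_def \<Lambda>[symmetric] image_subset_iff)
      show "NY (\<alpha> - \<beta>) \<le> 2 * \<epsilon>"
        if "\<alpha> \<in> {\<beta>. clsY (coord_iso num \<eta> \<beta>) \<in> cball (y i) \<epsilon>}"
          "\<beta> \<in> {\<beta>. clsY (coord_iso num \<eta> \<beta>) \<in> cball (y i) \<epsilon>}" for i \<alpha> \<beta>
      proof -
        have "NY (\<alpha> - \<beta>) = dist (clsY (coord_iso num \<eta> \<alpha>)) (clsY (coord_iso num \<eta> \<beta>))"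
          unfolding NY_def clsY dist_norm by (simp add: scaleR_diff_left sum_subtractf)
        also have "\<dots> \<le> 2 * \<epsilon>"
          using that dist_triangle_le[of "clsY (coord_iso num \<eta> \<alpha>)" "y i" "clsY (coord_iso num \<eta> \<beta>)"]
          by (simp add: dist_commute)
        finally show ?thesis .
      qed
    qed (use \<open>\<epsilon> > 0\<close> in auto)
    then have cov: "\<bar>det A\<bar> * ?vX \<le> 2 ^ (k - 1) * ((2 * \<epsilon>) ^ ?n * ?vY)" by simp
    \<comment> \<open>The Euclidean ball enters through the bound for \<open>NX\<close> and returns
      through the bound for \<open>NY\<close>; its positive volume then cancels.\<close>
    have "\<bar>det A\<bar> * ?v \<le> \<bar>det A\<bar> * (MX ^ ?n * ?vX)"
      unfolding MX_def by (intro mult_left_mono measure_cball_le_mean_norm assms NX) simp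
    also have "\<dots> = MX ^ ?n * (\<bar>det A\<bar> * ?vX)" by simp
    also have "\<dots> \<le> MX ^ ?n * (2 ^ (k - 1) * ((2 * \<epsilon>) ^ ?n * ?vY))"
      using M by (intro mult_left_mono cov) simp
    also have "\<dots> \<le> MX ^ ?n * (2 ^ (k - 1) * ((2 * \<epsilon>) ^ ?n * (MY ^ ?n * ?v)))"
      unfolding MY_def using M \<open>\<epsilon> > 0\<close>
      by (intro mult_left_mono measure_le_mean_dual_norm assms NY) simp_all
    also have "\<dots> = 2 ^ (k - 1) * (2 * \<epsilon> * (MX * MY)) ^ ?n * ?v"
      by (simp add: power_mult_distrib)
    finally have "\<bar>det A\<bar> \<le> 2 ^ (k - 1) * (2 * \<epsilon> * (MX * MY)) ^ ?n"
      using v by simp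
    then show ?thesis
      using pos \<open>\<epsilon> > 0\<close> by (intro cover_exponent_bound) auto
  qed (use \<open>\<epsilon> > 0\<close> in auto)
  \<comment> \<open>The infimum of the empty set is unspecified, so an admissible radius is
    exhibited: the image of the unit ball is bounded, and one large ball about 0, repeated, covers
    it.\<close>
  have "bounded (\<Lambda> ` cball 0 1)"
    using assms(11) bounded_subset[OF compact_imp_bounded closure_subset] by (auto simp: compact_operator_def)
  then obtain r where r: "r > 0" "\<And>z. z \<in> \<Lambda> ` cball 0 1 \<Longrightarrow> norm z \<le> r"
    unfolding bounded_pos by blast
  have "\<Lambda> ` cball 0 1 \<subseteq> (\<Union>i\<in>{1..2 ^ (k - 1) :: nat}. cball 0 r)"
    using r(2) by auto
  then have "r \<in> {\<epsilon>. \<epsilon> > 0 \<and> (\<exists>y::nat \<Rightarrow> 'y. \<Lambda> ` cball 0 1 \<subseteq> (\<Union>i\<in>{1..2 ^ (k - 1)}. cball (y i) \<epsilon>))}"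
    using r(1) by (intro CollectI conjI exI[of _ "\<lambda>_. 0"])
  then have ne: "{\<epsilon>. \<epsilon> > 0 \<and> (\<exists>y::nat \<Rightarrow> 'y. \<Lambda> ` cball 0 1 \<subseteq> (\<Union>i\<in>{1..2 ^ (k - 1)}. cball (y i) \<epsilon>))} \<noteq> {}"
    by (rule ex_in_conv[THEN iffD1, OF exI])
  show ?thesis
    unfolding entropy_number_def NX_def[symmetric] NY_def[symmetric] A_def[symmetric]
      MX_def[symmetric] MY_def[symmetric]
  proof (rule cInf_greatest[OF ne], elim CollectE conjE exE)
    fix \<epsilon> :: real and y :: "nat \<Rightarrow> 'y"
    assume "\<epsilon> > 0" "\<Lambda> ` cball 0 1 \<subseteq> (\<Union>i\<in>{1..2 ^ (k - 1)}. cball (y i) \<epsilon>)"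
    then show "2 powr (- 1 - real k / real CARD('n)) * (\<bar>det A\<bar> powr (1 / real CARD('n)) / (MX * MY)) \<le> \<epsilon>"
      by (rule bound)
  qed
qed

end
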